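(* There is an absolute constant $c>0$ such that for all $n\ge3$ the following holds. Let $X_1,\dots,X_m$ be nonzero real symmetric positive semidefinite $n\times n$ matrices with $\sum_{i=1}^mX_i=I$. Then there exists $S\subseteq[m]$ with $|S|\le n$ such that $\sum_{i\in S}X_i/\operatorname{tr}X_i$ has full rank $n$ and maximum eigenvalue at most $c\log n/\log\log n$. *)

theory Defs
  imports "Jordan_Normal_Form.DL_Rank" "Jordan_Normal_Form.Char_Poly"
begin

definition mtrace :: "real mat \<Rightarrow> real" where
  "mtrace A = (\<Sum>i<dim_row A. A $$ (i, i))"

definition symmetric_psd :: "nat \<Rightarrow> real mat \<Rightarrow> bool" where
  "symmetric_psd n A \<longleftrightarrow> A \<in> carrier_mat n n \<and> A\<^sup>T = A \<and>
     (\<forall>v \<in> carrier_vec n. 0 \<le> v \<bullet> (A *\<^sub>v v))"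

definition msum :: "nat \<Rightarrow> (nat \<Rightarrow> real mat) \<Rightarrow> nat set \<Rightarrow> real mat" where
  "msum n X S = mat n n (\<lambda>(i, j). \<Sum>k\<in>S. X k $$ (i, j))"

definition max_eigenvalue :: "real mat \<Rightarrow> real" where
  "max_eigenvalue A = Max {k. eigenvalue A k}"

end

theory Submission
  imports Defs "Jordan_Normal_Form.Spectral_Radius"
begin

text \<open>
  Write \<open>X\<^sub>i = \<Sum>\<^sub>j v\<^sub>i\<^sub>j v\<^sub>i\<^sub>j\<^sup>T\<close> and, for \<open>e = (i, j)\<close>, put \<open>A\<^sub>e = X\<^sub>i / tr X\<^sub>i\<close>. The vectors \<open>v\<^sub>e\<close> form a
  Parseval frame. A basis is selected greedily: if \<open>P\<close> is the orthogonal projection that is left,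
  choosing \<open>e\<close> with weight \<open>|P v\<^sub>e|\<^sup>2\<close> and replacing \<open>P\<close> by \<open>P - Q\<^sub>e\<close>, where \<open>Q\<^sub>e\<close> projects onto \<open>P v\<^sub>e\<close>,
  samples from the determinantal measure of the frame. With \<open>M\<close> the sum of the \<open>A\<^sub>e\<close> chosen so far
  and \<open>L(P) = \<Sum>\<^sub>e \<langle>v\<^sub>e, P v\<^sub>e\<rangle> A\<^sub>e\<close> the expectation of what is still to come, the potential
  \<open>tr exp (\<theta> M + \<kappa>' L(P))\<close> is a supermartingale when \<open>\<kappa>'\<close> is about \<open>exp (6 \<theta>)\<close>. It starts at
  \<open>n exp \<kappa>'\<close>, because \<open>L(I) = I\<close>, so some choice ends with \<open>\<theta> \<lambda>\<^sub>m\<^sub>a\<^sub>x(M) \<le> ln n + \<kappa>'\<close>, and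
  \<open>\<theta> = (ln ln n) / 6\<close> gives the bound.

  For the supermartingale property let \<open>K = (1 + \<kappa> \<Sum>\<^sub>e (P v\<^sub>e)(P v\<^sub>e)\<^sup>T \<otimes> A\<^sub>e)\<^sup>-\<^sup>1\<close> and let \<open>N\<^sub>e\<close> be its
  compression to \<open>q\<^sub>e \<otimes> \<real>\<^sup>n\<close>, where \<open>q\<^sub>e = P v\<^sub>e / |P v\<^sub>e|\<close>. Then \<open>1 - N\<^sub>e \<le> \<kappa> L(Q\<^sub>e)\<close>, so that
  \<open>\<theta> A\<^sub>e - \<kappa>' L(Q\<^sub>e) \<le> 2 \<theta> N\<^sub>e A\<^sub>e N\<^sub>e - (1 - N\<^sub>e)\<close> by the parallelogram inequality. The two summands
  on the right are separated by convexity of the trace exponential and then linearised with the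
  Golden-Thompson inequality; on average they cancel since \<open>\<kappa>\<close> times the mean of \<open>N\<^sub>e A\<^sub>e N\<^sub>e\<close> is at
  most the mean of \<open>1 - N\<^sub>e\<close>.
\<close>

section \<open>Spectral theorem over a finite index set\<close>

text \<open>Vectors and matrices are total functions of which only the entries with indices in \<open>I\<close>
  matter. This keeps the product associative without side conditions and makes tensor products
  available through pairs of indices.\<close>

definition dotp :: "'a set \<Rightarrow> ('a \<Rightarrow> real) \<Rightarrow> ('a \<Rightarrow> real) \<Rightarrow> real" where
  "dotp I x y = (\<Sum>i\<in>I. x i * y i)"

definition mvec :: "'b set \<Rightarrow> ('a \<Rightarrow> 'b \<Rightarrow> real) \<Rightarrow> ('b \<Rightarrow> real) \<Rightarrow> 'a \<Rightarrow> real" where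
  "mvec I A x = (\<lambda>i. \<Sum>j\<in>I. A i j * x j)"

abbreviation qform :: "'a set \<Rightarrow> ('a \<Rightarrow> 'a \<Rightarrow> real) \<Rightarrow> ('a \<Rightarrow> real) \<Rightarrow> real" where
  "qform I A x \<equiv> dotp I x (mvec I A x)"

text \<open>Symmetry is asked for at all indices, also outside the index set, so that
  \<open>symm_mvec_swap\<close> carries no membership conditions.\<close>

definition symm :: "('a \<Rightarrow> 'a \<Rightarrow> real) \<Rightarrow> bool" where
  "symm A \<longleftrightarrow> (\<forall>i j. A i j = A j i)"

text \<open>Serves as the unit matrix and, in the form \<open>kron i\<close>, as a coordinate
  vector.\<close>

definition kron :: "'a \<Rightarrow> 'a \<Rightarrow> real" where
  "kron i j = (if i = j then 1 else 0)"

definition mtr :: "'a set \<Rightarrow> ('a \<Rightarrow> 'a \<Rightarrow> real) \<Rightarrow> real" where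
  "mtr I A = (\<Sum>i\<in>I. A i i)"

text \<open>The family is indexed by \<open>I\<close> itself, so for finite \<open>I\<close> its
  size matches the dimension and orthonormality already yields completeness.\<close>

definition onb :: "'a set \<Rightarrow> ('a \<Rightarrow> 'a \<Rightarrow> real) \<Rightarrow> bool" where
  "onb I u \<longleftrightarrow> (\<forall>j\<in>I. \<forall>k\<in>I. dotp I (u j) (u k) = kron j k)"

definition eigbasis :: "'a set \<Rightarrow> ('a \<Rightarrow> 'a \<Rightarrow> real) \<Rightarrow> ('a \<Rightarrow> 'a \<Rightarrow> real) \<Rightarrow> ('a \<Rightarrow> real) \<Rightarrow> bool" where
  "eigbasis I A u d \<longleftrightarrow> onb I u \<and> (\<forall>k\<in>I. \<forall>i\<in>I. mvec I A (u k) i = d k * u k i)"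

section \<open>Bilinearity of the pairing and of matrix-vector application\<close>

lemma dotp_commute: "dotp I x y = dotp I y x"
  by (simp add: dotp_def mult.commute)

lemma dotp_cong: "(\<And>i. i \<in> I \<Longrightarrow> x i = x' i) \<Longrightarrow> (\<And>i. i \<in> I \<Longrightarrow> y i = y' i) \<Longrightarrow> dotp I x y = dotp I x' y'"
  by (simp add: dotp_def)

lemma mvec_cong: "(\<And>j. j \<in> I \<Longrightarrow> x j = y j) \<Longrightarrow> mvec I A x = mvec I A y"
  by (simp add: mvec_def)

lemma dotp_add_right: "dotp I x (\<lambda>i. y i + z i) = dotp I x y + dotp I x z"
  by (simp add: dotp_def algebra_simps sum.distrib)

lemma dotp_add_left: "dotp I (\<lambda>i. y i + z i) x = dotp I y x + dotp I z x"
  by (simp add: dotp_def algebra_simps sum.distrib)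

lemma dotp_diff_right: "dotp I x (\<lambda>i. y i - z i) = dotp I x y - dotp I x z"
  by (simp add: dotp_def algebra_simps sum_subtractf)

lemma dotp_diff_left: "dotp I (\<lambda>i. y i - z i) x = dotp I y x - dotp I z x"
  by (simp add: dotp_def algebra_simps sum_subtractf)

lemma dotp_scale_right: "dotp I x (\<lambda>i. c * y i) = c * dotp I x y"
  by (simp add: dotp_def sum_distrib_left algebra_simps)

lemma dotp_scale_left: "dotp I (\<lambda>i. c * y i) x = c * dotp I y x"
  by (simp add: dotp_def sum_distrib_left algebra_simps)

lemma dotp_sum_right: "dotp I x (\<lambda>i. \<Sum>k\<in>J. y k i) = (\<Sum>k\<in>J. dotp I x (y k))"
  unfolding dotp_def sum_distrib_left by (rule sum.swap)

lemma dotp_sum_left: "dotp I (\<lambda>i. \<Sum>k\<in>J. y k i) x = (\<Sum>k\<in>J. dotp I (y k) x)"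
  by (simp add: dotp_commute[of I _ x] dotp_sum_right)

lemmas dotp_linear = dotp_add_right dotp_add_left dotp_diff_right dotp_diff_left
  dotp_scale_right dotp_scale_left dotp_sum_right dotp_sum_left

lemma mvec_add: "mvec I A (\<lambda>i. x i + y i) = (\<lambda>i. mvec I A x i + mvec I A y i)"
  by (rule ext) (simp add: mvec_def algebra_simps sum.distrib)

lemma mvec_diff: "mvec I A (\<lambda>i. x i - y i) = (\<lambda>i. mvec I A x i - mvec I A y i)"
  by (rule ext) (simp add: mvec_def algebra_simps sum_subtractf)

lemma mvec_scale: "mvec I A (\<lambda>i. c * x i) = (\<lambda>i. c * mvec I A x i)"
  by (rule ext) (simp add: mvec_def algebra_simps sum_distrib_left)

lemma mvec_sum: "mvec I A (\<lambda>i. \<Sum>k\<in>J. x k i) = (\<lambda>i. \<Sum>k\<in>J. mvec I A (x k) i)"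
  unfolding mvec_def sum_distrib_left by (rule ext, rule sum.swap)

lemmas mvec_linear = mvec_add mvec_diff mvec_scale mvec_sum

lemma madd_mvec: "mvec I (\<lambda>i j. A i j + B i j) x = (\<lambda>i. mvec I A x i + mvec I B x i)"
  by (rule ext) (simp add: mvec_def algebra_simps sum.distrib)

lemma mdiff_mvec: "mvec I (\<lambda>i j. A i j - B i j) x = (\<lambda>i. mvec I A x i - mvec I B x i)"
  by (rule ext) (simp add: mvec_def algebra_simps sum_subtractf)

lemma mscale_mvec: "mvec I (\<lambda>i j. c * A i j) x = (\<lambda>i. c * mvec I A x i)"
  by (rule ext) (simp add: mvec_def algebra_simps sum_distrib_left)

lemma msum_mvec: "mvec I (\<lambda>i j. \<Sum>k\<in>J. A k i j) x = (\<lambda>i. \<Sum>k\<in>J. mvec I (A k) x i)"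
  unfolding mvec_def sum_distrib_right by (rule ext, rule sum.swap)

lemmas matrix_mvec_linear = madd_mvec mdiff_mvec mscale_mvec msum_mvec

lemma kron_mvec: "finite I \<Longrightarrow> i \<in> I \<Longrightarrow> mvec I kron x i = x i"
  by (simp add: mvec_def kron_def if_distrib[of "\<lambda>t. t * _"] sum.delta cong: if_cong)

lemma symm_mvec_swap:
  assumes "symm A"
  shows "dotp I x (mvec I A y) = dotp I (mvec I A x) y"
proof -
  have "dotp I x (mvec I A y) = (\<Sum>i\<in>I. \<Sum>j\<in>I. x i * A i j * y j)"
    by (simp add: dotp_def mvec_def sum_distrib_left algebra_simps)
  also have "\<dots> = (\<Sum>j\<in>I. \<Sum>i\<in>I. x i * A i j * y j)" by (rule sum.swap)
  also have "\<dots> = (\<Sum>j\<in>I. \<Sum>i\<in>I. x i * A j i * y j)"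
    using assms by (simp add: symm_def)
  also have "\<dots> = dotp I (mvec I A x) y"
    by (simp add: dotp_def mvec_def sum_distrib_left sum_distrib_right algebra_simps)
  finally show ?thesis .
qed

section \<open>Eigenvectors and orthonormal bases\<close>

lemma dotp_self_nonneg: "0 \<le> dotp I x x"
  by (simp add: dotp_def sum_nonneg)

lemma dotp_self_eq_0: "finite I \<Longrightarrow> dotp I x x = 0 \<longleftrightarrow> (\<forall>i\<in>I. x i = 0)"
  by (simp add: dotp_def sum_nonneg_eq_0_iff)

text \<open>Over the complex numbers an eigenvector \<open>a + ib\<close> with eigenvalue
  \<open>z\<close> exists. Symmetry forces \<open>Im z = 0\<close>, and then whichever of
  \<open>a\<close>, \<open>b\<close> is nonzero is a real eigenvector.\<close>

lemma symmetric_eigenpair_exists: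
  fixes A :: "nat \<Rightarrow> nat \<Rightarrow> real"
  assumes d: "0 < d" and A: "symm A"
  shows "\<exists>s x. (\<exists>i<d. x i \<noteq> 0) \<and> (\<forall>i<d. mvec {..<d} A x i = s * x i)"
proof -
  define M where "M = mat d d (\<lambda>(i,j). complex_of_real (A i j))"
  have M: "M \<in> carrier_mat d d" by (simp add: M_def)
  from spectrum_non_empty[OF M d] obtain z where "eigenvalue M z"
    unfolding spectrum_def by auto
  then obtain v where v: "v \<in> carrier_vec d" "v \<noteq> 0\<^sub>v d" and Mv: "M *\<^sub>v v = z \<cdot>\<^sub>v v"
    using M unfolding eigenvalue_def eigenvector_def by auto
  define a where "a i = Re (v $ i)" for i
  define b where "b i = Im (v $ i)" for i
  have eq: "(\<Sum>j<d. complex_of_real (A i j) * v $ j) = z * v $ i" if i: "i < d" for i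
  proof -
    have "(M *\<^sub>v v) $ i = (z \<cdot>\<^sub>v v) $ i" using Mv by simp
    with i v(1) show ?thesis
      by (simp add: M_def scalar_prod_def lessThan_atLeast0)
  qed
  have ra: "mvec {..<d} A a i = Re z * a i - Im z * b i" if "i < d" for i
    using arg_cong[OF eq[OF that], of Re] by (simp add: mvec_def a_def b_def)
  have rb: "mvec {..<d} A b i = Re z * b i + Im z * a i" if "i < d" for i
    using arg_cong[OF eq[OF that], of Im] by (simp add: mvec_def a_def b_def algebra_simps)
  \<comment> \<open>Pairing the real part of the eigenvalue equation with \<open>b\<close> and the
    imaginary part with \<open>a\<close> gives equal numbers; the cross terms cancel and
    \<open>Im z\<close> times \<open>|a|^2 + |b|^2\<close> remains.\<close>
  have "dotp {..<d} b (mvec {..<d} A a) = dotp {..<d} a (mvec {..<d} A b)"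
    using symm_mvec_swap[OF A] dotp_commute by metis
  moreover have "dotp {..<d} b (mvec {..<d} A a) = dotp {..<d} b (\<lambda>i. Re z * a i - Im z * b i)"
    by (rule dotp_cong) (simp_all add: ra)
  moreover have "dotp {..<d} a (mvec {..<d} A b) = dotp {..<d} a (\<lambda>i. Re z * b i + Im z * a i)"
    by (rule dotp_cong) (simp_all add: rb)
  ultimately have "Im z * (dotp {..<d} a a + dotp {..<d} b b) = 0"
    by (simp add: dotp_linear dotp_commute[of _ b a] algebra_simps)
  moreover have nz: "(\<exists>i<d. a i \<noteq> 0) \<or> (\<exists>i<d. b i \<noteq> 0)"
  proof (rule ccontr)
    assume "\<not> ?thesis"
    then have "\<forall>i<d. v $ i = 0" by (auto simp: a_def b_def complex_eq_iff)
    with v show False by (auto intro!: eq_vecI)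
  qed
  moreover have "dotp {..<d} a a + dotp {..<d} b b \<noteq> 0"
  proof
    assume "dotp {..<d} a a + dotp {..<d} b b = 0"
    then have "dotp {..<d} a a = 0" "dotp {..<d} b b = 0"
      using dotp_self_nonneg[of "{..<d}" a] dotp_self_nonneg[of "{..<d}" b] by linarith+
    with nz show False by (auto simp: dotp_self_eq_0)
  qed
  ultimately have "Im z = 0" by simp
  with ra rb have "\<forall>i<d. mvec {..<d} A a i = Re z * a i" "\<forall>i<d. mvec {..<d} A b i = Re z * b i"
    by auto
  with nz show ?thesis by metis
qed

text \<open>The \<open>k < n\<close> vectors, padded with zero rows to a square matrix, give
  determinant zero (expand along the zero row \<open>k\<close>). A normalised kernel vector is the
  required one.\<close>

lemma orthogonal_vector_exists:
  fixes u :: "nat \<Rightarrow> nat \<Rightarrow> real"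
  assumes k: "k < n"
  shows "\<exists>x. dotp {..<n} x x = 1 \<and> (\<forall>j<k. dotp {..<n} (u j) x = 0)"
proof -
  define M where "M = mat n n (\<lambda>(j,i). if j < k then u j i else 0)"
  have M: "M \<in> carrier_mat n n" by (simp add: M_def)
  have "det M = 0"
  proof -
    have "det M = (\<Sum>i<n. M $$ (k, i) * cofactor M k i)"
      by (rule laplace_expansion_row[OF M k])
    also have "\<dots> = 0" using k by (simp add: M_def)
    finally show ?thesis .
  qed
  then obtain v where v: "v \<in> carrier_vec n" "v \<noteq> 0\<^sub>v n" "M *\<^sub>v v = 0\<^sub>v n"
    using det_0_iff_vec_prod_zero_field[OF M] by auto
  define y where "y i = v $ i" for i
  have orth: "dotp {..<n} (u j) y = 0" if j: "j < k" for j
  proof -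
    have "(M *\<^sub>v v) $ j = 0" using v(3) j k by simp
    then show ?thesis using j k v(1)
      by (simp add: M_def scalar_prod_def lessThan_atLeast0 dotp_def y_def)
  qed
  have "\<not> (\<forall>i<n. y i = 0)"
    using v(1,2) by (auto simp: y_def intro!: eq_vecI)
  then have "dotp {..<n} y y \<noteq> 0" by (auto simp: dotp_self_eq_0)
  then have pos: "0 < dotp {..<n} y y" using dotp_self_nonneg[of "{..<n}" y] by linarith
  define x where "x = (\<lambda>i. (1 / sqrt (dotp {..<n} y y)) * y i)"
  have "dotp {..<n} x x = 1"
    using pos unfolding x_def dotp_linear by (simp add: field_simps)
  moreover have "\<forall>j<k. dotp {..<n} (u j) x = 0"
    unfolding x_def dotp_linear using orth by simp
  ultimately show ?thesis by blast
qed

lemma orthonormal_extension: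
  fixes u :: "nat \<Rightarrow> nat \<Rightarrow> real"
  assumes "k \<le> n" "\<forall>i<k. \<forall>j<k. dotp {..<n} (u i) (u j) = kron i j"
  shows "\<exists>w. (\<forall>i<k. w i = u i) \<and> onb {..<n} w"
proof -
  have "l \<le> n \<Longrightarrow> \<exists>w. (\<forall>i<k. w i = u i) \<and> (\<forall>i<l. \<forall>j<l. dotp {..<n} (w i) (w j) = kron i j)"
    if "k \<le> l" for l
    using that
  proof (induction l rule: dec_induct)
    case base
    then show ?case using assms by auto
  next
    case (step l)
    then obtain w where w: "\<forall>i<k. w i = u i" "\<forall>i<l. \<forall>j<l. dotp {..<n} (w i) (w j) = kron i j"
      by auto
    from orthogonal_vector_exists[of l n w] step.prems obtain x
      where x: "dotp {..<n} x x = 1" "\<forall>j<l. dotp {..<n} (w j) x = 0" by auto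
    have x': "\<forall>j<l. dotp {..<n} x (w j) = 0" using x(2) dotp_commute by metis
    have "(\<forall>i<k. (w(l := x)) i = u i) \<and>
      (\<forall>i<Suc l. \<forall>j<Suc l. dotp {..<n} ((w(l := x)) i) ((w(l := x)) j) = kron i j)"
      using w x x' step.hyps by (auto simp: less_Suc_eq kron_def)
    then show ?case by blast
  qed
  from this[of n] assms(1) show ?thesis unfolding onb_def by auto
qed

lemma left_inverse_imp_right_inverse:
  fixes a b :: "'a \<Rightarrow> 'a \<Rightarrow> real"
  assumes I: "finite I"
    and ab: "\<forall>i\<in>I. \<forall>j\<in>I. (\<Sum>k\<in>I. a i k * b k j) = kron i j"
    and ij: "i \<in> I" "j \<in> I"
  shows "(\<Sum>k\<in>I. b i k * a k j) = kron i j"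
proof -
  obtain h where h: "bij_betw h {..<card I} I"
    using ex_bij_betw_nat_finite[OF I] by (auto simp: lessThan_atLeast0)
  let ?n = "card I"
  define A where "A = mat ?n ?n (\<lambda>(r,s). a (h r) (h s))"
  define B where "B = mat ?n ?n (\<lambda>(r,s). b (h r) (h s))"
  have c: "A \<in> carrier_mat ?n ?n" "B \<in> carrier_mat ?n ?n" by (simp_all add: A_def B_def)
  have hI: "h r \<in> I" if "r < ?n" for r using h that by (auto simp: bij_betw_def)
  have hinj: "h r = h s \<longleftrightarrow> r = s" if "r < ?n" "s < ?n" for r s
    using h that by (auto simp: bij_betw_def inj_on_def)
  have reindex: "(\<Sum>k\<in>I. f k) = (\<Sum>r<?n. f (h r))" for f :: "'a \<Rightarrow> real"
    using sum.reindex_bij_betw[OF h, of f] by simp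
  have "A * B = 1\<^sub>m ?n"
  proof (rule eq_matI)
    fix r s assume "r < dim_row (1\<^sub>m ?n :: real mat)" "s < dim_col (1\<^sub>m ?n :: real mat)"
    then have rs: "r < ?n" "s < ?n" by auto
    have "(A * B) $$ (r,s) = (\<Sum>k\<in>I. a (h r) k * b k (h s))"
      using rs unfolding reindex by (simp add: A_def B_def scalar_prod_def lessThan_atLeast0)
    also have "\<dots> = (1\<^sub>m ?n) $$ (r,s)" using rs ab hI hinj by (simp add: kron_def)
    finally show "(A * B) $$ (r,s) = (1\<^sub>m ?n) $$ (r,s)" .
  qed (simp_all add: A_def B_def)
  from mat_mult_left_right_inverse[OF c this] have BA: "B * A = 1\<^sub>m ?n" .
  obtain r s where rs: "r < ?n" "s < ?n" "i = h r" "j = h s"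
    using h ij unfolding bij_betw_def by (metis imageE lessThan_iff)
  have "(\<Sum>k\<in>I. b i k * a k j) = (B * A) $$ (r,s)"
    using rs unfolding reindex by (simp add: A_def B_def scalar_prod_def lessThan_atLeast0)
  also have "\<dots> = kron i j" unfolding BA using rs hinj by (simp add: kron_def)
  finally show ?thesis .
qed

text \<open>The square matrix with rows \<open>u k\<close> has its transpose as right inverse, hence
  also as left inverse.\<close>

lemma onb_complete:
  assumes "finite I" "onb I u" "i \<in> I" "j \<in> I"
  shows "(\<Sum>k\<in>I. u k i * u k j) = kron i j"
proof -
  have "\<forall>i\<in>I. \<forall>j\<in>I. (\<Sum>k\<in>I. u i k * (\<lambda>k j. u j k) k j) = kron i j"
    using assms(2) by (simp add: onb_def dotp_def)
  from left_inverse_imp_right_inverse[OF assms(1) this assms(3,4)] show ?thesis by simp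
qed

lemma onb_expansion:
  assumes "finite I" "onb I u" "i \<in> I"
  shows "x i = (\<Sum>k\<in>I. dotp I (u k) x * u k i)"
proof -
  have "(\<Sum>k\<in>I. dotp I (u k) x * u k i) = (\<Sum>k\<in>I. \<Sum>j\<in>I. u k i * u k j * x j)"
    by (simp add: dotp_def sum_distrib_right sum_distrib_left algebra_simps)
  also have "\<dots> = (\<Sum>j\<in>I. \<Sum>k\<in>I. u k i * u k j * x j)" by (rule sum.swap)
  also have "\<dots> = (\<Sum>j\<in>I. kron i j * x j)"
    using onb_complete[OF assms(1,2,3)] by (simp add: sum_distrib_right[symmetric])
  also have "\<dots> = x i" using kron_mvec[OF assms(1,3), of x] by (simp add: mvec_def)
  finally show ?thesis by simp
qed

lemma onb_parseval:
  assumes "finite I" "onb I u"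
  shows "dotp I x y = (\<Sum>k\<in>I. dotp I (u k) x * dotp I (u k) y)"
proof -
  have "dotp I x y = dotp I (\<lambda>i. \<Sum>k\<in>I. dotp I (u k) x * u k i) y"
    by (rule dotp_cong) (use onb_expansion[OF assms] in auto)
  then show ?thesis by (simp add: dotp_linear)
qed

lemma onb_eqI:
  assumes "finite I" "onb I u" "\<And>k. k \<in> I \<Longrightarrow> dotp I (u k) x = dotp I (u k) y" "i \<in> I"
  shows "x i = y i"
  using onb_expansion[OF assms(1,2,4), of x] onb_expansion[OF assms(1,2,4), of y] assms(3)
  by simp

lemma mtr_onb:
  assumes "finite I" "onb I u"
  shows "mtr I Z = (\<Sum>k\<in>I. qform I Z (u k))"
proof -
  have "(\<Sum>k\<in>I. qform I Z (u k)) = (\<Sum>k\<in>I. \<Sum>i\<in>I. \<Sum>j\<in>I. Z i j * (u k i * u k j))"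
    by (simp add: dotp_def mvec_def sum_distrib_left algebra_simps)
  also have "\<dots> = (\<Sum>i\<in>I. \<Sum>k\<in>I. \<Sum>j\<in>I. Z i j * (u k i * u k j))" by (rule sum.swap)
  also have "\<dots> = (\<Sum>i\<in>I. \<Sum>j\<in>I. \<Sum>k\<in>I. Z i j * (u k i * u k j))"
    by (rule sum.cong[OF refl], rule sum.swap)
  also have "\<dots> = (\<Sum>i\<in>I. \<Sum>j\<in>I. kron i j * Z i j)"
    using onb_complete[OF assms] by (simp add: sum_distrib_left[symmetric] mult.commute)
  also have "\<dots> = (\<Sum>i\<in>I. Z i i)"
  proof (rule sum.cong[OF refl])
    fix i assume "i \<in> I"
    then show "(\<Sum>j\<in>I. kron i j * Z i j) = Z i i"
      using kron_mvec[OF assms(1), of i "Z i"] by (simp add: mvec_def)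
  qed
  finally show ?thesis by (simp add: mtr_def)
qed

text \<open>Eigenvectors are collected one at a time. The \<open>k\<close> found so far are
  completed to an orthonormal basis \<open>w\<close>; in the remaining basis vectors
  \<open>A\<close> acts through the symmetric matrix \<open>S\<close>, and an eigenvector
  \<open>y\<close> of \<open>S\<close> lifts to a new eigenvector \<open>x\<close> of
  \<open>A\<close>.\<close>

lemma spectral_theorem_nat:
  fixes A :: "nat \<Rightarrow> nat \<Rightarrow> real"
  assumes A: "symm A"
  shows "\<exists>u d. eigbasis {..<n} A u d"
proof -
  let ?I = "{..<n}"
  have "k \<le> n \<Longrightarrow> \<exists>u d. (\<forall>i<k. \<forall>j<k. dotp ?I (u i) (u j) = kron i j) \<and>
     (\<forall>j<k. \<forall>i<n. mvec ?I A (u j) i = d j * u j i)" for k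
  proof (induction k)
    case 0
    then show ?case by simp
  next
    case (Suc k)
    then obtain u d where u: "\<forall>i<k. \<forall>j<k. dotp ?I (u i) (u j) = kron i j"
      and ev: "\<forall>j<k. \<forall>i<n. mvec ?I A (u j) i = d j * u j i" by auto
    from orthonormal_extension[of k n u] u Suc.prems obtain w
      where w: "\<forall>i<k. w i = u i" "onb ?I w" by auto
    define m where "m = n - k"
    define S where "S i j = dotp ?I (w (k + i)) (mvec ?I A (w (k + j)))" for i j
    have "symm S" unfolding symm_def S_def
      using symm_mvec_swap[OF A] dotp_commute by metis
    from symmetric_eigenpair_exists[OF _ this, of m] Suc.prems obtain s y
      where nz: "\<exists>i<m. y i \<noteq> 0" and y: "\<forall>i<m. mvec {..<m} S y i = s * y i"
      by (auto simp: m_def)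
    define x where "x = (\<lambda>i. \<Sum>l<m. y l * w (k + l) i)"
    have wx: "dotp ?I (w j) x = (if j < k then 0 else y (j - k))" if j: "j < n" for j
    proof -
      have "dotp ?I (w j) x = (\<Sum>l<m. y l * kron j (k + l))"
        using w(2) j unfolding x_def dotp_linear by (auto simp: onb_def m_def intro!: sum.cong)
      also have "\<dots> = (if j < k then 0 else y (j - k))"
      proof (cases "j < k")
        case False
        then have "(\<Sum>l<m. y l * kron j (k + l)) = (\<Sum>l<m. if l = j - k then y l else 0)"
          by (intro sum.cong) (auto simp: kron_def)
        with False j show ?thesis by (simp add: m_def)
      qed (auto simp: kron_def intro!: sum.neutral)
      finally show ?thesis .
    qed
    \<comment> \<open>Compare coordinates in the basis \<open>w\<close>. Below \<open>k\<close>
      symmetry moves \<open>A\<close> onto a known eigenvector, to which \<open>x\<close> is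
      orthogonal; from \<open>k\<close> on this is the eigenvalue equation of
      \<open>S\<close>.\<close>
    have Ax: "mvec ?I A x i = s * x i" if i: "i < n" for i
    proof (rule onb_eqI[of ?I w])
      fix j assume "j \<in> ?I"
      then have j: "j < n" by simp
      show "dotp ?I (w j) (mvec ?I A x) = dotp ?I (w j) (\<lambda>i. s * x i)"
      proof (cases "j < k")
        case True
        have "dotp ?I (w j) (mvec ?I A x) = dotp ?I (mvec ?I A (w j)) x"
          by (rule symm_mvec_swap[OF A])
        also have "\<dots> = dotp ?I (\<lambda>i. d j * w j i) x"
          by (rule dotp_cong) (use True w(1) ev in auto)
        finally show ?thesis using True wx[OF j] by (simp add: dotp_linear)
      next
        case False
        have "dotp ?I (w j) (mvec ?I A x) = (\<Sum>l<m. y l * dotp ?I (w j) (mvec ?I A (w (k + l))))"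
          unfolding x_def mvec_linear dotp_linear ..
        also have "\<dots> = mvec {..<m} S y (j - k)"
          using False by (simp add: mvec_def S_def mult.commute)
        also have "\<dots> = s * y (j - k)" using y False j by (simp add: m_def)
        finally show ?thesis using False wx[OF j] by (simp add: dotp_linear)
      qed
    qed (use w(2) i in auto)
    have "dotp ?I x x \<noteq> 0"
    proof
      assume "dotp ?I x x = 0"
      then have "\<forall>i<n. x i = 0" by (simp add: dotp_self_eq_0)
      then have "dotp ?I (w j) x = 0" for j by (simp add: dotp_def)
      with nz wx[of "k + i" for i] show False by (auto simp: m_def)
    qed
    then have pos: "0 < dotp ?I x x" using dotp_self_nonneg[of ?I x] by linarith
    define x' where "x' = (\<lambda>i. (1 / sqrt (dotp ?I x x)) * x i)"
    have n1: "dotp ?I x' x' = 1" using pos unfolding x'_def dotp_linear by (simp add: field_simps)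
    have "dotp ?I (u j) x = 0" if "j < k" for j
      using wx[of j] w(1) Suc.prems that by simp
    then have o1: "\<forall>j<k. dotp ?I (u j) x' = 0" unfolding x'_def dotp_linear by simp
    then have o2: "\<forall>j<k. dotp ?I x' (u j) = 0" using dotp_commute by metis
    have e1: "\<forall>i<n. mvec ?I A x' i = s * x' i"
      unfolding x'_def mvec_linear using Ax by simp
    have "(\<forall>i<Suc k. \<forall>j<Suc k. dotp ?I ((u(k:=x')) i) ((u(k:=x')) j) = kron i j) \<and>
     (\<forall>j<Suc k. \<forall>i<n. mvec ?I A ((u(k:=x')) j) i = (d(k:=s)) j * (u(k:=x')) j i)"
      using u ev n1 o1 o2 e1 by (auto simp: less_Suc_eq kron_def)
    then show ?case by blast
  qed
  from this[of n] show ?thesis unfolding eigbasis_def onb_def Ball_def lessThan_iff by blast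
qed

theorem spectral_theorem:
  assumes I: "finite I" and A: "symm A"
  shows "\<exists>u d. eigbasis I A u d"
proof -
  let ?n = "card I"
  obtain h where h: "bij_betw h {..<?n} I"
    using ex_bij_betw_nat_finite[OF I] by (auto simp: lessThan_atLeast0)
  define g where "g = the_inv_into {..<?n} h"
  have gh: "g (h r) = r" if "r < ?n" for r
    using h that by (auto simp: g_def bij_betw_def the_inv_into_f_f)
  have gI: "g i < ?n" "h (g i) = i" if "i \<in> I" for i
    using h that gh unfolding bij_betw_def by force+
  have ginj: "g i = g j \<longleftrightarrow> i = j" if "i \<in> I" "j \<in> I" for i j using gI that by metis
  have reindex: "(\<Sum>k\<in>I. f k) = (\<Sum>r<?n. f (h r))" for f :: "'a \<Rightarrow> real"
    using sum.reindex_bij_betw[OF h, of f] by simp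
  have "symm (\<lambda>r s. A (h r) (h s))" using A by (simp add: symm_def)
  from spectral_theorem_nat[OF this] obtain u d
    where ud: "eigbasis {..<?n} (\<lambda>r s. A (h r) (h s)) u d" by blast
  have "eigbasis I A (\<lambda>k i. u (g k) (g i)) (\<lambda>k. d (g k))"
    unfolding eigbasis_def
  proof (intro conjI ballI)
    show "onb I (\<lambda>k i. u (g k) (g i))"
      unfolding onb_def dotp_def reindex
      using ud gI ginj by (auto simp: eigbasis_def onb_def dotp_def gh kron_def)
  next
    fix k i assume ki: "k \<in> I" "i \<in> I"
    then have "mvec {..<?n} (\<lambda>r s. A (h r) (h s)) (u (g k)) (g i) = d (g k) * u (g k) (g i)"
      using ud gI(1) by (simp add: eigbasis_def)
    then show "mvec I A (\<lambda>i. u (g k) (g i)) i = d (g k) * u (g k) (g i)"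
      unfolding mvec_def reindex using ki gI(2) by (simp add: gh)
  qed
  then show ?thesis by blast
qed

section \<open>The trace exponential\<close>

text \<open>The trace of the matrix exponential, read off from the eigenvalues of one chosen
  eigenbasis. \<open>trexp_eigbasis\<close> exposes that basis to later proofs.\<close>

definition trexp :: "'a set \<Rightarrow> ('a \<Rightarrow> 'a \<Rightarrow> real) \<Rightarrow> real" where
  "trexp I X = (\<Sum>k\<in>I. exp (snd (SOME ud. eigbasis I X (fst ud) (snd ud)) k))"

lemma trexp_eigbasis:
  assumes "finite I" "symm X"
  obtains u d where "eigbasis I X u d" "trexp I X = (\<Sum>k\<in>I. exp (d k))"
proof -
  define ud where "ud = (SOME ud. eigbasis I X (fst ud) (snd ud))"
  have "\<exists>ud. eigbasis I X (fst ud) (snd ud)"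
    using spectral_theorem[OF assms] by auto
  then have "eigbasis I X (fst ud) (snd ud)" unfolding ud_def by (rule someI_ex)
  then show thesis by (rule that) (simp add: trexp_def ud_def)
qed

lemma eigbasis_bilinear:
  assumes I: "finite I" and X: "symm X" and e: "eigbasis I X u d"
  shows "dotp I x (mvec I X y) = (\<Sum>k\<in>I. d k * (dotp I (u k) x * dotp I (u k) y))"
proof -
  have o: "onb I u" using e by (simp add: eigbasis_def)
  have "dotp I (u k) (mvec I X y) = d k * dotp I (u k) y" if "k \<in> I" for k
  proof -
    have "dotp I (u k) (mvec I X y) = dotp I (mvec I X (u k)) y" by (rule symm_mvec_swap[OF X])
    also have "\<dots> = dotp I (\<lambda>i. d k * u k i) y"
      by (rule dotp_cong) (use e that in \<open>auto simp: eigbasis_def\<close>)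
    finally show ?thesis by (simp add: dotp_linear)
  qed
  then show ?thesis
    unfolding onb_parseval[OF I o, of x] by (intro sum.cong) auto
qed

lemma eigbasis_qform:
  assumes "finite I" "symm X" "eigbasis I X u d"
  shows "qform I X x = (\<Sum>k\<in>I. d k * (dotp I (u k) x)\<^sup>2)"
  using eigbasis_bilinear[OF assms, of x x] by (simp add: power2_eq_square)

lemma eigbasis_eigenvalue:
  assumes "eigbasis I X u d" "k \<in> I"
  shows "d k = qform I X (u k)"
proof -
  have "qform I X (u k) = dotp I (u k) (\<lambda>i. d k * u k i)"
    by (rule dotp_cong) (use assms in \<open>auto simp: eigbasis_def\<close>)
  then show ?thesis using assms by (simp add: dotp_linear eigbasis_def onb_def kron_def)
qed

text \<open>Average the tangent line of \<open>exp\<close> at the mean \<open>m\<close>.\<close>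

lemma exp_Jensen:
  fixes c d :: "'a \<Rightarrow> real"
  assumes "\<And>k. k \<in> I \<Longrightarrow> 0 \<le> c k" "(\<Sum>k\<in>I. c k) = 1"
  shows "exp (\<Sum>k\<in>I. d k * c k) \<le> (\<Sum>k\<in>I. exp (d k) * c k)"
proof -
  define m where "m = (\<Sum>k\<in>I. d k * c k)"
  have "exp m = (\<Sum>k\<in>I. exp m * (1 + (d k - m)) * c k)"
  proof -
    have "(\<Sum>k\<in>I. exp m * (1 + (d k - m)) * c k)
      = exp m * ((1 - m) * (\<Sum>k\<in>I. c k) + (\<Sum>k\<in>I. d k * c k))"
      by (simp add: sum_distrib_left sum.distrib[symmetric] algebra_simps)
    then show ?thesis by (simp add: assms(2) m_def)
  qed
  also have "\<dots> \<le> (\<Sum>k\<in>I. exp (d k) * c k)"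
  proof (rule sum_mono)
    fix k assume "k \<in> I"
    have "exp m * (1 + (d k - m)) \<le> exp m * exp (d k - m)"
      by (intro mult_left_mono exp_ge_add_one_self) simp
    also have "\<dots> = exp (d k)" by (simp add: exp_add[symmetric])
    finally show "exp m * (1 + (d k - m)) * c k \<le> exp (d k) * c k"
      using assms(1)[OF \<open>k \<in> I\<close>] by (rule mult_right_mono)
  qed
  finally show ?thesis by (simp add: m_def)
qed

lemma exp_qform_le:
  assumes "finite I" "symm X" "eigbasis I X u d" "dotp I x x = 1"
  shows "exp (qform I X x) \<le> (\<Sum>k\<in>I. exp (d k) * (dotp I (u k) x)\<^sup>2)"
proof -
  have "onb I u" using assms(3) by (simp add: eigbasis_def)
  from onb_parseval[OF assms(1) this, of x x] assms(4)
  have "(\<Sum>k\<in>I. (dotp I (u k) x)\<^sup>2) = 1" by (simp add: power2_eq_square)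
  then show ?thesis
    unfolding eigbasis_qform[OF assms(1-3)] by (intro exp_Jensen) auto
qed

text \<open>Turns a bound on the trace exponential into a bound on every eigenvalue.\<close>

lemma exp_qform_le_trexp:
  assumes "finite I" "symm X" "dotp I x x = 1"
  shows "exp (qform I X x) \<le> trexp I X"
proof -
  obtain u d where e: "eigbasis I X u d" and t: "trexp I X = (\<Sum>k\<in>I. exp (d k))"
    using trexp_eigbasis[OF assms(1,2)] .
  have o: "onb I u" using e by (simp add: eigbasis_def)
  have 1: "(\<Sum>k\<in>I. (dotp I (u k) x)\<^sup>2) = 1"
    using onb_parseval[OF assms(1) o, of x x] assms(3) by (simp add: power2_eq_square)
  have "exp (qform I X x) \<le> (\<Sum>k\<in>I. exp (d k) * (dotp I (u k) x)\<^sup>2)"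
    by (rule exp_qform_le[OF assms(1,2) e assms(3)])
  also have "\<dots> \<le> (\<Sum>k\<in>I. exp (d k) * 1)"
  proof (rule sum_mono, rule mult_left_mono)
    fix k assume k: "k \<in> I"
    show "(dotp I (u k) x)\<^sup>2 \<le> 1"
      using member_le_sum[OF k, of "\<lambda>k. (dotp I (u k) x)\<^sup>2"] assms(1) 1 by simp
  qed simp
  finally show ?thesis by (simp add: t)
qed

text \<open>Apply Jensen to each \<open>w k\<close> and exchange the sums: every eigenvector of
  \<open>X\<close> collects total weight 1, by Parseval for \<open>w\<close>.\<close>

lemma Peierls_inequality:
  assumes "finite I" "symm X" "onb I w"
  shows "(\<Sum>k\<in>I. exp (qform I X (w k))) \<le> trexp I X"
proof -
  obtain u d where e: "eigbasis I X u d" and t: "trexp I X = (\<Sum>k\<in>I. exp (d k))"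
    using trexp_eigbasis[OF assms(1,2)] .
  have o: "onb I u" using e by (simp add: eigbasis_def)
  have "(\<Sum>k\<in>I. exp (qform I X (w k))) \<le> (\<Sum>k\<in>I. \<Sum>l\<in>I. exp (d l) * (dotp I (u l) (w k))\<^sup>2)"
    using assms(3) by (intro sum_mono exp_qform_le[OF assms(1,2) e]) (auto simp: onb_def kron_def)
  also have "\<dots> = (\<Sum>l\<in>I. \<Sum>k\<in>I. exp (d l) * (dotp I (u l) (w k))\<^sup>2)" by (rule sum.swap)
  also have "\<dots> = (\<Sum>l\<in>I. exp (d l) * dotp I (u l) (u l))"
    by (intro sum.cong refl)
      (simp add: onb_parseval[OF assms(1,3), of "u _" "u _"] sum_distrib_left power2_eq_square
        dotp_commute[of I "w _"])
  also have "\<dots> = trexp I X" unfolding t using o by (intro sum.cong) (auto simp: onb_def kron_def)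
  finally show ?thesis .
qed

text \<open>In the eigenbasis of \<open>Z\<close> the claim becomes scalar monotonicity and midpoint
  convexity of \<open>exp\<close>, followed by the Peierls inequality for \<open>X\<close> and
  \<open>Y\<close>. The case \<open>X = Y\<close> is monotonicity.\<close>

lemma trexp_midpoint_le:
  assumes I: "finite I" and s: "symm Z" "symm X" "symm Y"
    and le: "\<And>x. qform I Z x \<le> (qform I X x + qform I Y x) / 2"
  shows "trexp I Z \<le> (trexp I X + trexp I Y) / 2"
proof -
  obtain u d where e: "eigbasis I Z u d" and t: "trexp I Z = (\<Sum>k\<in>I. exp (d k))"
    using trexp_eigbasis[OF I s(1)] .
  have o: "onb I u" using e by (simp add: eigbasis_def)
  have mid: "exp ((a + b) / 2) \<le> (exp a + exp b) / 2" for a b :: real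
  proof -
    have "(exp (a / 2) - exp (b / 2))\<^sup>2 \<ge> 0" by simp
    then show ?thesis
      by (simp add: power2_diff exp_double[symmetric] exp_add add_divide_distrib)
  qed
  have "trexp I Z \<le> (\<Sum>k\<in>I. (exp (qform I X (u k)) + exp (qform I Y (u k))) / 2)"
    unfolding t
  proof (rule sum_mono)
    fix k assume "k \<in> I"
    then have "exp (d k) \<le> exp ((qform I X (u k) + qform I Y (u k)) / 2)"
      using le[of "u k"] eigbasis_eigenvalue[OF e] by simp
    with mid show "exp (d k) \<le> (exp (qform I X (u k)) + exp (qform I Y (u k))) / 2"
      by (rule order_trans[rotated])
  qed
  also have "\<dots> = ((\<Sum>k\<in>I. exp (qform I X (u k))) + (\<Sum>k\<in>I. exp (qform I Y (u k)))) / 2"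
    by (simp add: sum_divide_distrib[symmetric] sum.distrib)
  also have "\<dots> \<le> (trexp I X + trexp I Y) / 2"
    using Peierls_inequality[OF I s(2) o] Peierls_inequality[OF I s(3) o] by simp
  finally show ?thesis .
qed

lemma trexp_mono:
  assumes "finite I" "symm X" "symm Y" "\<And>x. qform I X x \<le> qform I Y x"
  shows "trexp I X \<le> trexp I Y"
  using trexp_midpoint_le[OF assms(1,2,3,3)] assms(4) by simp

lemma trexp_scalar:
  assumes "finite I" "symm X" "\<And>x. qform I X x = c * dotp I x x"
  shows "trexp I X = real (card I) * exp c"
proof -
  obtain u d where e: "eigbasis I X u d" and t: "trexp I X = (\<Sum>k\<in>I. exp (d k))"
    using trexp_eigbasis[OF assms(1,2)] .
  have "d k = c" if "k \<in> I" for k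
    using eigbasis_eigenvalue[OF e that] assms(3)[of "u k"] e that
    by (simp add: eigbasis_def onb_def kron_def)
  then show ?thesis by (simp add: t)
qed

section \<open>The Golden-Thompson inequality\<close>

definition mmult :: "'a set \<Rightarrow> ('a \<Rightarrow> 'a \<Rightarrow> real) \<Rightarrow> ('a \<Rightarrow> 'a \<Rightarrow> real) \<Rightarrow> 'a \<Rightarrow> 'a \<Rightarrow> real" where
  "mmult I A B = (\<lambda>i j. \<Sum>k\<in>I. A i k * B k j)"

definition mtransp :: "('a \<Rightarrow> 'a \<Rightarrow> real) \<Rightarrow> 'a \<Rightarrow> 'a \<Rightarrow> real" where
  "mtransp A = (\<lambda>i j. A j i)"

text \<open>\<open>msq I k A\<close> is the power of \<open>A\<close> with exponent \<open>2\<^sup>k\<close>; repeated squaring needs no unit matrix.\<close>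

fun msq :: "'a set \<Rightarrow> nat \<Rightarrow> ('a \<Rightarrow> 'a \<Rightarrow> real) \<Rightarrow> 'a \<Rightarrow> 'a \<Rightarrow> real" where
  "msq I 0 A = A"
| "msq I (Suc k) A = msq I k (mmult I A A)"

lemma mmult_assoc: "mmult I (mmult I A B) C = mmult I A (mmult I B C)"
proof (intro ext)
  fix i j
  have "mmult I (mmult I A B) C i j = (\<Sum>l\<in>I. \<Sum>k\<in>I. A i k * B k l * C l j)"
    by (simp add: mmult_def sum_distrib_right)
  also have "\<dots> = (\<Sum>k\<in>I. \<Sum>l\<in>I. A i k * B k l * C l j)" by (rule sum.swap)
  also have "\<dots> = mmult I A (mmult I B C) i j"
    by (simp add: mmult_def sum_distrib_left mult.assoc)
  finally show "mmult I (mmult I A B) C i j = mmult I A (mmult I B C) i j" .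
qed

lemma mvec_mmult: "mvec I (mmult I A B) x = mvec I A (mvec I B x)"
proof (intro ext)
  fix i
  have "mvec I (mmult I A B) x i = (\<Sum>l\<in>I. \<Sum>k\<in>I. A i k * B k l * x l)"
    by (simp add: mmult_def mvec_def sum_distrib_right)
  also have "\<dots> = (\<Sum>k\<in>I. \<Sum>l\<in>I. A i k * B k l * x l)" by (rule sum.swap)
  also have "\<dots> = mvec I A (mvec I B x) i"
    by (simp add: mvec_def sum_distrib_left mult.assoc)
  finally show "mvec I (mmult I A B) x i = mvec I A (mvec I B x) i" .
qed

lemma mtransp_mmult: "mtransp (mmult I A B) = mmult I (mtransp B) (mtransp A)"
  by (simp add: mtransp_def mmult_def mult.commute)

lemma mtransp_mtransp [simp]: "mtransp (mtransp A) = A"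
  by (simp add: mtransp_def)

lemma symm_iff_mtransp: "symm A \<longleftrightarrow> mtransp A = A"
  by (auto simp: symm_def mtransp_def fun_eq_iff)

lemma symm_mmult_mtransp: "symm (mmult I M (mtransp M))" "symm (mmult I (mtransp M) M)"
  by (simp_all add: symm_iff_mtransp mtransp_mmult)

lemma symm_mmult_self: "symm A \<Longrightarrow> symm (mmult I A A)"
  by (simp add: symm_iff_mtransp mtransp_mmult)

lemma symm_msq: "symm A \<Longrightarrow> symm (msq I k A)"
  by (induction k arbitrary: A) (auto simp: symm_mmult_self)

section \<open>Trace inequalities for powers with exponent \<open>2\<^sup>k\<close>\<close>

lemma mtr_mmult_commute: "mtr I (mmult I A B) = mtr I (mmult I B A)"
  unfolding mtr_def mmult_def by (subst sum.swap) (simp add: mult.commute)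

lemma mmult_msq: "mmult I (msq I k A) (msq I k A) = msq I (Suc k) A"
  by (induction k arbitrary: A) auto

text \<open>Since \<open>(AB)\<^sup>2 = (ABA) B\<close> and \<open>B (ABA) = (BA)\<^sup>2\<close>,
  the induction hypothesis for the pair \<open>ABA\<close>, \<open>B\<close> gives the next
  power.\<close>

lemma mtr_msq_commute: "mtr I (msq I k (mmult I A B)) = mtr I (msq I k (mmult I B A))"
proof (induction k arbitrary: A B)
  case 0
  then show ?case by (simp add: mtr_mmult_commute)
next
  case (Suc k)
  show ?case using Suc[of "mmult I A (mmult I B A)" B] by (simp add: mmult_assoc)
qed

text \<open>The squared Hilbert-Schmidt norm of \<open>M\<close> minus its transpose is
  nonnegative.\<close>

lemma mtr_square_le: "mtr I (mmult I M M) \<le> mtr I (mmult I M (mtransp M))"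
proof -
  let ?D = "\<lambda>i j. M i j - M j i"
  have "0 \<le> (\<Sum>i\<in>I. \<Sum>k\<in>I. ?D i k * ?D i k)" by (simp add: sum_nonneg)
  also have "\<dots> = (\<Sum>i\<in>I. \<Sum>k\<in>I. M i k * M i k) + (\<Sum>i\<in>I. \<Sum>k\<in>I. M k i * M k i)
      - 2 * (\<Sum>i\<in>I. \<Sum>k\<in>I. M i k * M k i)"
    by (simp add: algebra_simps sum.distrib sum_subtractf sum_distrib_left)
  also have "(\<Sum>i\<in>I. \<Sum>k\<in>I. M k i * M k i) = (\<Sum>i\<in>I. \<Sum>k\<in>I. M i k * M i k)"
    by (rule sum.swap)
  finally show ?thesis by (simp add: mtr_def mmult_def mtransp_def)
qed

lemma mtr_mmult_symm_le:
  assumes "symm A" "symm B"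
  shows "2 * mtr I (mmult I A B) \<le> mtr I (mmult I A A) + mtr I (mmult I B B)"
proof -
  let ?D = "\<lambda>i j. A i j - B i j"
  have c: "(\<Sum>i\<in>I. \<Sum>k\<in>I. F i k * G i k) = (\<Sum>i\<in>I. \<Sum>k\<in>I. F i k * G k i)"
    if "symm G" for F G :: "'a \<Rightarrow> 'a \<Rightarrow> real"
    by (intro sum.cong refl arg_cong2[of _ _ _ _ "(*)"]) (use that in \<open>simp add: symm_def\<close>)
  have "0 \<le> (\<Sum>i\<in>I. \<Sum>k\<in>I. ?D i k * ?D i k)" by (simp add: sum_nonneg)
  also have "\<dots> = (\<Sum>i\<in>I. \<Sum>k\<in>I. A i k * A i k) + (\<Sum>i\<in>I. \<Sum>k\<in>I. B i k * B i k)
      - 2 * (\<Sum>i\<in>I. \<Sum>k\<in>I. A i k * B i k)"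
    by (simp add: algebra_simps sum.distrib sum_subtractf sum_distrib_left)
  also have "\<dots> = (\<Sum>i\<in>I. \<Sum>k\<in>I. A i k * A k i) + (\<Sum>i\<in>I. \<Sum>k\<in>I. B i k * B k i)
      - 2 * (\<Sum>i\<in>I. \<Sum>k\<in>I. A i k * B k i)"
    by (simp only: c assms)
  finally show ?thesis by (simp add: mtr_def mmult_def)
qed

text \<open>With \<open>p = 2\<^sup>j\<close> the claims are
  \<open>tr M\<^sup>2\<^sup>p \<le> tr (M M\<^sup>T)\<^sup>p\<close> and the Lieb-Thirring
  inequality \<open>tr (RS)\<^sup>p \<le> tr (R\<^sup>p S\<^sup>p)\<close>. They are proved together
  because the first claim for \<open>Suc j\<close> needs both claims for \<open>j\<close>, and so
  does the second.\<close>

lemma mtr_msq_Lieb_Thirring_aux: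
  "(\<forall>M. mtr I (msq I (Suc j) M) \<le> mtr I (msq I j (mmult I M (mtransp M)))) \<and>
   (\<forall>R S. symm R \<longrightarrow> symm S \<longrightarrow>
      mtr I (msq I j (mmult I R S)) \<le> mtr I (mmult I (msq I j R) (msq I j S)))"
proof (induction j)
  case 0
  then show ?case by (simp add: mtr_square_le)
next
  case (Suc j)
  then have C: "\<And>M. mtr I (msq I (Suc j) M) \<le> mtr I (msq I j (mmult I M (mtransp M)))"
    and L: "\<And>R S. symm R \<Longrightarrow> symm S \<Longrightarrow>
      mtr I (msq I j (mmult I R S)) \<le> mtr I (mmult I (msq I j R) (msq I j S))"
    by blast+
  show ?case
  proof (intro conjI allI impI)
    fix M
    let ?R = "mmult I (mtransp M) M" and ?S = "mmult I M (mtransp M)"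
    have "mtr I (msq I (Suc (Suc j)) M) = mtr I (msq I (Suc j) (mmult I M M))" by simp
    also have "\<dots> \<le> mtr I (msq I j (mmult I (mmult I M M) (mtransp (mmult I M M))))" by (rule C)
    also have "\<dots> = mtr I (msq I j (mmult I M (mmult I M (mmult I (mtransp M) (mtransp M)))))"
      by (simp add: mtransp_mmult mmult_assoc)
    also have "\<dots> = mtr I (msq I j (mmult I (mmult I M (mmult I M (mtransp M))) (mtransp M)))"
      by (simp add: mmult_assoc)
    \<comment> \<open>Moving one transpose to the front regroups the product into two symmetric
      factors, as the second claim requires.\<close>
    also have "\<dots> = mtr I (msq I j (mmult I (mtransp M) (mmult I M (mmult I M (mtransp M)))))"
      by (rule mtr_msq_commute)
    also have "\<dots> = mtr I (msq I j (mmult I ?R ?S))" by (simp add: mmult_assoc)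
    also have "\<dots> \<le> mtr I (mmult I (msq I j ?R) (msq I j ?S))"
      by (intro L symm_mmult_mtransp)
    also have "\<dots> \<le> (mtr I (msq I (Suc j) ?R) + mtr I (msq I (Suc j) ?S)) / 2"
      using mtr_mmult_symm_le[of "msq I j ?R" "msq I j ?S" I]
      by (simp add: symm_mmult_mtransp symm_msq mmult_msq del: msq.simps)
    \<comment> \<open>By cyclicity the two averaged traces coincide.\<close>
    also have "\<dots> = mtr I (msq I (Suc j) ?S)"
      using mtr_msq_commute[of I "Suc j" "mtransp M" M] by (simp del: msq.simps)
    finally show "mtr I (msq I (Suc (Suc j)) M) \<le> mtr I (msq I (Suc j) (mmult I M (mtransp M)))" .
  next
    fix R S :: "'a \<Rightarrow> 'a \<Rightarrow> real" assume s: "symm R" "symm S"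
    \<comment> \<open>The first claim for \<open>M = RS\<close>, where
      \<open>M M\<^sup>T = R S S R\<close>; cyclicity then gives the product of the squares of
      \<open>R\<close> and \<open>S\<close>.\<close>
    have "mtr I (msq I (Suc j) (mmult I R S))
        \<le> mtr I (msq I j (mmult I (mmult I R S) (mtransp (mmult I R S))))" by (rule C)
    also have "\<dots> = mtr I (msq I j (mmult I (mmult I R (mmult I S S)) R))"
      using s by (simp add: mtransp_mmult mmult_assoc symm_iff_mtransp)
    also have "\<dots> = mtr I (msq I j (mmult I R (mmult I R (mmult I S S))))"
      by (rule mtr_msq_commute)
    also have "\<dots> = mtr I (msq I j (mmult I (mmult I R R) (mmult I S S)))"
      by (simp add: mmult_assoc)
    also have "\<dots> \<le> mtr I (mmult I (msq I j (mmult I R R)) (msq I j (mmult I S S)))"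
      using s by (intro L symm_mmult_self)
    finally show "mtr I (msq I (Suc j) (mmult I R S))
        \<le> mtr I (mmult I (msq I (Suc j) R) (msq I (Suc j) S))" by simp
  qed
qed

lemma mtr_msq_Lieb_Thirring:
  assumes "symm R" "symm S"
  shows "mtr I (msq I j (mmult I R S)) \<le> mtr I (mmult I (msq I j R) (msq I j S))"
  using mtr_msq_Lieb_Thirring_aux[of I j] assms by blast

section \<open>Maximal row sums as a submultiplicative norm, and the Trotter error\<close>

definition rowbd :: "'a set \<Rightarrow> ('a \<Rightarrow> 'a \<Rightarrow> real) \<Rightarrow> real \<Rightarrow> bool" where
  "rowbd I A c \<longleftrightarrow> (\<forall>i\<in>I. (\<Sum>j\<in>I. \<bar>A i j\<bar>) \<le> c)"

lemma rowbd_mono: "rowbd I A c \<Longrightarrow> c \<le> d \<Longrightarrow> rowbd I A d"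
  by (force simp: rowbd_def)

lemma rowbd_add:
  assumes "rowbd I A c" "rowbd I B d"
  shows "rowbd I (\<lambda>i j. A i j + B i j) (c + d)"
  unfolding rowbd_def
proof
  fix i assume "i \<in> I"
  have "(\<Sum>j\<in>I. \<bar>A i j + B i j\<bar>) \<le> (\<Sum>j\<in>I. \<bar>A i j\<bar> + \<bar>B i j\<bar>)"
    by (intro sum_mono abs_triangle_ineq)
  also have "\<dots> \<le> c + d" using assms \<open>i \<in> I\<close> by (auto simp: rowbd_def sum.distrib intro: add_mono)
  finally show "(\<Sum>j\<in>I. \<bar>A i j + B i j\<bar>) \<le> c + d" .
qed

lemma rowbd_mmult:
  assumes "rowbd I A c" "rowbd I B d" "0 \<le> d"
  shows "rowbd I (mmult I A B) (c * d)"
  unfolding rowbd_def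
proof
  fix i assume i: "i \<in> I"
  have "(\<Sum>j\<in>I. \<bar>mmult I A B i j\<bar>) \<le> (\<Sum>j\<in>I. \<Sum>k\<in>I. \<bar>A i k\<bar> * \<bar>B k j\<bar>)"
    unfolding mmult_def by (intro sum_mono order_trans[OF sum_abs]) (simp add: abs_mult)
  also have "\<dots> = (\<Sum>k\<in>I. \<bar>A i k\<bar> * (\<Sum>j\<in>I. \<bar>B k j\<bar>))"
    by (subst sum.swap) (simp add: sum_distrib_left)
  also have "\<dots> \<le> (\<Sum>k\<in>I. \<bar>A i k\<bar> * d)"
    using assms(2) by (intro sum_mono mult_left_mono) (auto simp: rowbd_def)
  also have "\<dots> \<le> c * d"
    using assms(1,3) i by (simp add: sum_distrib_right[symmetric] rowbd_def mult_right_mono)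
  finally show "(\<Sum>j\<in>I. \<bar>mmult I A B i j\<bar>) \<le> c * d" .
qed

text \<open>One squaring replaces \<open>e\<close> by \<open>2 M e\<close> and \<open>M\<close> by
  \<open>M\<^sup>2\<close>, because
  \<open>C\<^sup>2 - D\<^sup>2 = C (C - D) + (C - D) D\<close>.\<close>

lemma rowbd_msq_diff:
  assumes "rowbd I C M" "rowbd I D M" "rowbd I (\<lambda>i j. C i j - D i j) e" "1 \<le> M" "0 \<le> e"
  shows "rowbd I (\<lambda>i j. msq I k C i j - msq I k D i j) (2 ^ k * e * M ^ (2 ^ k - 1))"
  using assms
proof (induction k arbitrary: C D M e)
  case 0
  then show ?case by simp
next
  case (Suc k)
  let ?E = "\<lambda>i j. C i j - D i j"
  have eq: "(\<lambda>i j. mmult I C C i j - mmult I D D i j) = (\<lambda>i j. mmult I C ?E i j + mmult I ?E D i j)"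
    by (simp add: mmult_def fun_eq_iff sum.distrib[symmetric] sum_subtractf[symmetric] algebra_simps)
  have a: "rowbd I (\<lambda>i j. mmult I C C i j - mmult I D D i j) (M * e + e * M)"
    unfolding eq using Suc.prems by (intro rowbd_add rowbd_mmult) auto
  have b: "rowbd I (mmult I C C) (M * M)" "rowbd I (mmult I D D) (M * M)"
    using Suc.prems by (auto intro!: rowbd_mmult)
  have c: "1 \<le> M * M" "0 \<le> M * e + e * M"
    using Suc.prems mult_mono[of 1 M 1 M] by auto
  \<comment> \<open>Writing \<open>2\<^sup>k\<close> as \<open>q + 1\<close> turns the truncated
    subtractions in the exponents into \<open>q\<close> and \<open>2q + 1\<close>.\<close>
  obtain q :: nat where q: "2 ^ k = Suc q" by (metis not0_implies_Suc power_not_zero zero_neq_numeral)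
  have "2 ^ k * (M * e + e * M) * (M * M) ^ (2 ^ k - 1) = 2 ^ Suc k * e * M ^ (2 ^ Suc k - 1)"
  proof -
    have "(M * M) ^ q = M ^ (2 * q)" by (simp add: power_mult power2_eq_square)
    moreover have "2 ^ Suc k - 1 = Suc (2 * q)" using q by simp
    ultimately show ?thesis using q by simp
  qed
  then show ?case using Suc.IH[OF b a c] by (simp only: msq.simps)
qed

lemma abs_mtr_le_rowbd:
  assumes "rowbd I A c" "finite I"
  shows "\<bar>mtr I A\<bar> \<le> real (card I) * c"
proof -
  have "\<bar>mtr I A\<bar> \<le> (\<Sum>i\<in>I. \<bar>A i i\<bar>)" unfolding mtr_def by (rule sum_abs)
  also have "\<dots> \<le> (\<Sum>i\<in>I. c)"
  proof (rule sum_mono)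
    fix i assume "i \<in> I"
    then have "\<bar>A i i\<bar> \<le> (\<Sum>j\<in>I. \<bar>A i j\<bar>)"
      using assms(2) by (intro member_le_sum) auto
    also have "\<dots> \<le> c" using assms(1) \<open>i \<in> I\<close> by (simp add: rowbd_def)
    finally show "\<bar>A i i\<bar> \<le> c" .
  qed
  finally show ?thesis by simp
qed

lemma eigbasis_msq:
  assumes "eigbasis I A u d"
  shows "eigbasis I (msq I k A) u (\<lambda>l. d l ^ (2 ^ k))"
  using assms
proof (induction k arbitrary: A d)
  case 0
  then show ?case by simp
next
  case (Suc k)
  have "eigbasis I (mmult I A A) u (\<lambda>l. d l ^ 2)"
    unfolding eigbasis_def mvec_mmult
  proof (intro conjI ballI)
    show "onb I u" using Suc.prems by (simp add: eigbasis_def)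
    fix l i assume li: "l \<in> I" "i \<in> I"
    have "mvec I A (mvec I A (u l)) i = mvec I A (\<lambda>i. d l * u l i) i"
      by (rule fun_cong[OF mvec_cong]) (use Suc.prems li in \<open>simp add: eigbasis_def\<close>)
    then show "mvec I A (mvec I A (u l)) i = (d l)\<^sup>2 * u l i"
      using Suc.prems li by (simp add: mvec_linear eigbasis_def power2_eq_square)
  qed
  from Suc.IH[OF this] show ?case by (simp add: power_mult[symmetric])
qed

lemma eigbasis_kron_add:
  assumes "finite I" "eigbasis I X u d"
  shows "eigbasis I (\<lambda>i j. kron i j + c * X i j) u (\<lambda>l. 1 + c * d l)"
  using assms unfolding eigbasis_def matrix_mvec_linear
  by (auto simp: kron_mvec algebra_simps)

lemma mtr_mmult_eigbasis:
  assumes I: "finite I" and A: "eigbasis I A u a" "symm A" and B: "eigbasis I B w b" "symm B"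
  shows "mtr I (mmult I A B) = (\<Sum>k\<in>I. a k * (\<Sum>l\<in>I. b l * (dotp I (w l) (u k))\<^sup>2))"
proof -
  have o: "onb I u" using A by (simp add: eigbasis_def)
  have "qform I (mmult I A B) (u k) = a k * qform I B (u k)" if "k \<in> I" for k
  proof -
    have "qform I (mmult I A B) (u k) = dotp I (mvec I A (u k)) (mvec I B (u k))"
      unfolding mvec_mmult by (rule symm_mvec_swap[OF A(2)])
    also have "\<dots> = dotp I (\<lambda>i. a k * u k i) (mvec I B (u k))"
      by (rule dotp_cong) (use A(1) that in \<open>auto simp: eigbasis_def\<close>)
    finally show ?thesis by (simp add: dotp_linear)
  qed
  then show ?thesis
    unfolding mtr_onb[OF I o] by (simp add: eigbasis_qform[OF I B(2,1)])
qed

lemma mtr_eigbasis: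
  assumes "finite I" "eigbasis I A u a"
  shows "mtr I A = (\<Sum>k\<in>I. a k)"
proof -
  have "onb I u" using assms by (simp add: eigbasis_def)
  then show ?thesis
    unfolding mtr_onb[OF assms(1) \<open>onb I u\<close>]
    using eigbasis_eigenvalue[OF assms(2)] by (intro sum.cong) auto
qed

lemma exp_limit_powers_of_two: "(\<lambda>k. (1 + x / 2 ^ k) ^ (2 ^ k)) \<longlonglongrightarrow> exp (x :: real)"
proof -
  have "filterlim (\<lambda>k::nat. 2 ^ k :: nat) at_top sequentially"
    by (rule filterlim_subseq) (simp add: strict_mono_def)
  from filterlim_compose[OF tendsto_exp_limit_sequentially this, of x] show ?thesis by simp
qed

lemma symm_kron_add: "symm X \<Longrightarrow> symm (\<lambda>i j. kron i j + c * X i j)"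
  by (auto simp: symm_def kron_def)

lemma rowbd_kron: "finite I \<Longrightarrow> rowbd I kron 1"
  by (simp add: rowbd_def kron_def if_distrib[of abs] cong: if_cong)

lemma rowbd_exists:
  assumes "finite I"
  shows "\<exists>c\<ge>0. rowbd I X c"
proof -
  have "rowbd I X (\<Sum>i\<in>I. \<Sum>j\<in>I. \<bar>X i j\<bar>)"
    unfolding rowbd_def using assms by (intro ballI member_le_sum) (auto simp: sum_nonneg)
  then show ?thesis by (intro exI[of _ "\<Sum>i\<in>I. \<Sum>j\<in>I. \<bar>X i j\<bar>"]) (auto simp: sum_nonneg)
qed

lemma rowbd_scale:
  assumes "rowbd I X c" "0 \<le> t"
  shows "rowbd I (\<lambda>i j. t * X i j) (t * c)"
  using assms by (simp add: rowbd_def abs_mult sum_distrib_left[symmetric] mult_left_mono)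

text \<open>The factor \<open>(1 + X/p) (1 + Y/p)\<close> differs from \<open>1 + (X + Y)/p\<close> by \<open>O(1/p\<^sup>2)\<close>, so that the
  \<open>p\<close>-th powers, \<open>p = 2\<^sup>k\<close>, differ by \<open>O(1/p)\<close>.\<close>

lemma mtr_msq_trotter_error:
  fixes X Y :: "'a \<Rightarrow> 'a \<Rightarrow> real"
  assumes I: "finite I" and bd: "rowbd I X a" "rowbd I Y a" "0 \<le> a"
  defines "\<And>k. C k \<equiv> mmult I (\<lambda>i j. kron i j + (1/2^k) * X i j) (\<lambda>i j. kron i j + (1/2^k) * Y i j)"
  defines "\<And>k. D k \<equiv> (\<lambda>i j. kron i j + (1/2^k) * (X i j + Y i j))"
  shows "mtr I (msq I k (D k)) \<le> mtr I (msq I k (C k)) + real (card I) * (a\<^sup>2 * exp (2 * a)) * (1/2) ^ k"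
proof -
  let ?t = "1 / 2 ^ k :: real"
  \<comment> \<open>A common row-sum bound for both matrices whose power with exponent
    \<open>2\<^sup>k\<close> stays below \<open>exp (2 * a)\<close> for every
    \<open>k\<close>.\<close>
  let ?M = "(1 + ?t * a) * (1 + ?t * a)"
  have t: "0 \<le> ?t" by simp
  have ta: "0 \<le> ?t * a" using bd(3) by simp
  have K: "rowbd I kron 1" by (rule rowbd_kron[OF I])
  have Cb: "rowbd I (C k) ?M"
    unfolding C_def using ta by (intro rowbd_mmult rowbd_add rowbd_scale K bd t) simp
  have "rowbd I (D k) (1 + ?t * (a + a))"
    unfolding D_def by (intro rowbd_add rowbd_scale K bd t)
  then have Db: "rowbd I (D k) ?M"
    by (rule rowbd_mono) (simp add: algebra_simps)
  have diff: "C k i j - D k i j = (?t * ?t) * mmult I X Y i j" if "i \<in> I" "j \<in> I" for i j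
  proof -
    have k1: "(\<Sum>l\<in>I. kron i l * f l) = f i" for f :: "'a \<Rightarrow> real"
      using kron_mvec[OF I that(1), of f] by (simp add: mvec_def)
    have k2: "(\<Sum>l\<in>I. f l * kron l j) = f j" for f :: "'a \<Rightarrow> real"
    proof -
      have "(\<Sum>l\<in>I. f l * kron l j) = (\<Sum>l\<in>I. kron j l * f l)"
        by (intro sum.cong) (auto simp: kron_def)
      then show ?thesis using kron_mvec[OF I that(2), of f] by (simp add: mvec_def)
    qed
    have "C k i j = (\<Sum>l\<in>I. kron i l * (kron l j + ?t * Y l j)) + ?t * (\<Sum>l\<in>I. X i l * kron l j)
       + (?t * ?t) * mmult I X Y i j"
      unfolding C_def mmult_def
      by (simp add: algebra_simps sum.distrib sum_distrib_left sum_divide_distrib)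
    also have "\<dots> = kron i j + ?t * Y i j + ?t * X i j + (?t * ?t) * mmult I X Y i j"
      unfolding k1 k2 ..
    finally show ?thesis by (simp add: D_def algebra_simps add_divide_distrib)
  qed
  have "rowbd I (\<lambda>i j. (?t * ?t) * mmult I X Y i j) ((?t * ?t) * (a * a))"
    using bd by (intro rowbd_scale rowbd_mmult) auto
  then have "rowbd I (\<lambda>i j. C k i j - D k i j) ((?t * ?t) * (a * a))"
    unfolding rowbd_def by (simp add: diff)
  then have dif: "rowbd I (\<lambda>i j. D k i j - C k i j) ((?t * ?t) * (a * a))"
    unfolding rowbd_def by (simp add: abs_minus_commute)
  have M1: "1 \<le> ?M" using ta mult_mono[of 1 "1 + ?t * a" 1 "1 + ?t * a"] by simp
  have "?M ^ (2 ^ k - 1) \<le> ?M ^ (2 ^ k)" using M1 by (intro power_increasing) auto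
  also have "\<dots> \<le> (exp (?t * a) * exp (?t * a)) ^ (2 ^ k)"
    using ta exp_ge_add_one_self[of "?t * a"] by (intro power_mono mult_mono) auto
  also have "\<dots> = exp (2 * a)"
    by (simp add: exp_add[symmetric] exp_of_nat_mult[symmetric])
  finally have Mp: "?M ^ (2 ^ k - 1) \<le> exp (2 * a)" .
  have "rowbd I (\<lambda>i j. msq I k (D k) i j - msq I k (C k) i j) (2 ^ k * ((?t * ?t) * (a * a)) * ?M ^ (2 ^ k - 1))"
    by (rule rowbd_msq_diff[OF Db Cb dif M1]) simp
  then have "\<bar>mtr I (\<lambda>i j. msq I k (D k) i j - msq I k (C k) i j)\<bar>
      \<le> real (card I) * (2 ^ k * ((?t * ?t) * (a * a)) * ?M ^ (2 ^ k - 1))"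
    by (rule abs_mtr_le_rowbd[OF _ I])
  also have "\<dots> \<le> real (card I) * (2 ^ k * ((?t * ?t) * (a * a)) * exp (2 * a))"
    using Mp by (intro mult_left_mono) auto
  also have "\<dots> = real (card I) * (a\<^sup>2 * exp (2 * a)) * (1/2) ^ k"
    by (simp add: power2_eq_square power_divide)
  finally show ?thesis by (simp add: mtr_def sum_subtractf)
qed

text \<open>The right side is the trace of \<open>exp X\<close> times \<open>exp Y\<close>, written
  in the two eigenbases. For \<open>p = 2\<^sup>k\<close> the trace of the \<open>p\<close>-th power
  of \<open>1 + (X + Y)/p\<close> is compared, up to the Trotter error, with that of
  \<open>(1 + X/p)(1 + Y/p)\<close>; Lieb-Thirring separates the factors, and \<open>k\<close> tends
  to infinity in the eigenvalues.\<close>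

theorem Golden_Thompson:
  assumes I: "finite I" and X: "symm X" "eigbasis I X u d" and Y: "symm Y" "eigbasis I Y w c"
  shows "trexp I (\<lambda>i j. X i j + Y i j) \<le> (\<Sum>k\<in>I. exp (d k) * (\<Sum>l\<in>I. exp (c l) * (dotp I (w l) (u k))\<^sup>2))"
proof -
  let ?Z = "\<lambda>i j. X i j + Y i j"
  have Z: "symm ?Z" using X(1) Y(1) by (simp add: symm_def)
  obtain v b where vb: "eigbasis I ?Z v b" and t: "trexp I ?Z = (\<Sum>k\<in>I. exp (b k))"
    using trexp_eigbasis[OF I Z] .
  obtain a where a: "0 \<le> a" "rowbd I X a" "rowbd I Y a"
  proof -
    obtain a1 a2 where "0 \<le> a1" "rowbd I X a1" "0 \<le> a2" "rowbd I Y a2"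
      using rowbd_exists[OF I] by metis
    then show thesis
      by (intro that[of "max a1 a2"]) (auto intro: rowbd_mono[of _ _ a1] rowbd_mono[of _ _ a2])
  qed
  define err where "err = real (card I) * (a\<^sup>2 * exp (2 * a))"
  have step: "(\<Sum>l\<in>I. (1 + b l / 2 ^ k) ^ (2 ^ k)) \<le>
     (\<Sum>m\<in>I. (1 + d m / 2 ^ k) ^ (2 ^ k) * (\<Sum>l\<in>I. (1 + c l / 2 ^ k) ^ (2 ^ k) * (dotp I (w l) (u m))\<^sup>2))
     + err * (1/2) ^ k" for k
  proof -
    let ?A = "\<lambda>i j. kron i j + (1/2^k) * X i j" and ?B = "\<lambda>i j. kron i j + (1/2^k) * Y i j"
    have s: "symm ?A" "symm ?B" by (intro symm_kron_add X Y)+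
    have "(\<Sum>l\<in>I. (1 + (1/2^k) * b l) ^ (2 ^ k)) = mtr I (msq I k (\<lambda>i j. kron i j + (1/2^k) * ?Z i j))"
      by (rule mtr_eigbasis[symmetric, OF I eigbasis_msq[OF eigbasis_kron_add[OF I vb]]])
    also have "\<dots> \<le> mtr I (msq I k (mmult I ?A ?B)) + err * (1/2) ^ k"
      unfolding err_def by (rule mtr_msq_trotter_error[OF I a(2,3,1)])
    also have "mtr I (msq I k (mmult I ?A ?B)) \<le> mtr I (mmult I (msq I k ?A) (msq I k ?B))"
      by (rule mtr_msq_Lieb_Thirring[OF s])
    also have "\<dots> = (\<Sum>m\<in>I. (1 + (1/2^k) * d m) ^ (2 ^ k) *
        (\<Sum>l\<in>I. (1 + (1/2^k) * c l) ^ (2 ^ k) * (dotp I (w l) (u m))\<^sup>2))"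
      by (intro mtr_mmult_eigbasis I eigbasis_msq eigbasis_kron_add symm_msq s X Y)
    finally show ?thesis by simp
  qed
  have "(\<lambda>k. \<Sum>l\<in>I. (1 + b l / 2 ^ k) ^ (2 ^ k)) \<longlonglongrightarrow> (\<Sum>k\<in>I. exp (b k))"
    by (intro tendsto_sum exp_limit_powers_of_two)
  moreover have "(\<lambda>k. (\<Sum>m\<in>I. (1 + d m / 2 ^ k) ^ (2 ^ k) *
      (\<Sum>l\<in>I. (1 + c l / 2 ^ k) ^ (2 ^ k) * (dotp I (w l) (u m))\<^sup>2)) + err * (1/2) ^ k)
    \<longlonglongrightarrow> (\<Sum>m\<in>I. exp (d m) * (\<Sum>l\<in>I. exp (c l) * (dotp I (w l) (u m))\<^sup>2)) + err * 0"
    by (intro tendsto_sum tendsto_add tendsto_mult exp_limit_powers_of_two tendsto_const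
        LIMSEQ_power_zero) simp
  ultimately have "(\<Sum>k\<in>I. exp (b k)) \<le>
      (\<Sum>m\<in>I. exp (d m) * (\<Sum>l\<in>I. exp (c l) * (dotp I (w l) (u m))\<^sup>2)) + err * 0"
    by (rule LIMSEQ_le) (use step in blast)
  then show ?thesis by (simp add: t)
qed

text \<open>Golden-Thompson, followed by replacing \<open>exp\<close> with a line on an interval
  containing the spectrum of \<open>U\<close>. The bound is affine in \<open>U\<close> with weights
  depending only on \<open>H\<close>, so it can be averaged over \<open>U\<close>.\<close>

lemma trexp_add_le:
  assumes I: "finite I" and H: "symm H" "eigbasis I H u d" and U: "symm U"
    and lo: "\<And>x. lo * dotp I x x \<le> qform I U x" and hi: "\<And>x. qform I U x \<le> hi * dotp I x x"
    and chord: "\<And>t. lo \<le> t \<Longrightarrow> t \<le> hi \<Longrightarrow> exp t \<le> 1 + b * t"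
  shows "trexp I (\<lambda>i j. H i j + U i j) \<le> (\<Sum>k\<in>I. exp (d k) * (1 + b * qform I U (u k)))"
proof -
  obtain w c where wc: "eigbasis I U w c" using spectral_theorem[OF I U] by blast
  have ow: "onb I w" using wc by (simp add: eigbasis_def)
  have ou: "onb I u" using H by (simp add: eigbasis_def)
  have c: "exp (c l) \<le> 1 + b * c l" if "l \<in> I" for l
  proof (rule chord)
    have "dotp I (w l) (w l) = 1" using ow that by (simp add: onb_def kron_def)
    then show "lo \<le> c l" "c l \<le> hi"
      using lo[of "w l"] hi[of "w l"] eigbasis_eigenvalue[OF wc that] by auto
  qed
  have "trexp I (\<lambda>i j. H i j + U i j)
      \<le> (\<Sum>k\<in>I. exp (d k) * (\<Sum>l\<in>I. exp (c l) * (dotp I (w l) (u k))\<^sup>2))"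
    by (rule Golden_Thompson[OF I H U wc])
  also have "\<dots> \<le> (\<Sum>k\<in>I. exp (d k) * (\<Sum>l\<in>I. (1 + b * c l) * (dotp I (w l) (u k))\<^sup>2))"
    using c by (intro sum_mono mult_left_mono mult_right_mono) auto
  also have "\<dots> = (\<Sum>k\<in>I. exp (d k) * (1 + b * qform I U (u k)))"
  proof (rule sum.cong[OF refl])
    fix k assume k: "k \<in> I"
    have "(\<Sum>l\<in>I. (1 + b * c l) * (dotp I (w l) (u k))\<^sup>2)
        = (\<Sum>l\<in>I. (dotp I (w l) (u k))\<^sup>2) + b * (\<Sum>l\<in>I. c l * (dotp I (w l) (u k))\<^sup>2)"
      by (simp add: distrib_right sum.distrib sum_distrib_left mult.assoc)
    also have "(\<Sum>l\<in>I. (dotp I (w l) (u k))\<^sup>2) = dotp I (u k) (u k)"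
      unfolding onb_parseval[OF I ow, of "u k" "u k"] by (simp add: power2_eq_square)
    also have "\<dots> = 1" using ou k by (simp add: onb_def kron_def)
    finally show "exp (d k) * (\<Sum>l\<in>I. (1 + b * c l) * (dotp I (w l) (u k))\<^sup>2)
        = exp (d k) * (1 + b * qform I U (u k))"
      by (simp add: eigbasis_qform[OF I U wc])
  qed
  finally show ?thesis .
qed

section \<open>The supermartingale inequality\<close>

text \<open>Convexity of \<open>exp\<close> between \<open>0\<close> and \<open>h\<close>, where
  \<open>h\<close> may have either sign, from the tangent line at \<open>t * h\<close> evaluated at
  both ends.\<close>

lemma exp_chord:
  fixes h t :: real
  assumes "0 \<le> t" "t \<le> 1"
  shows "exp (t * h) \<le> 1 + (exp h - 1) * t"
proof -
  let ?m = "t * h"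
  have "1 = t * (1 + (h - ?m)) + (1 - t) * (1 + (0 - ?m))" by (simp add: algebra_simps)
  also have "\<dots> \<le> t * exp (h - ?m) + (1 - t) * exp (0 - ?m)"
    using assms exp_ge_add_one_self[of "h - ?m"] exp_ge_add_one_self[of "0 - ?m"]
    by (intro add_mono mult_left_mono) auto
  finally have "exp ?m * 1 \<le> exp ?m * (t * exp (h - ?m) + (1 - t) * exp (0 - ?m))"
    by (intro mult_left_mono) auto
  also have "\<dots> = t * (exp ?m * exp (h - ?m)) + (1 - t) * (exp ?m * exp (0 - ?m))"
    by (simp add: algebra_simps)
  also have "\<dots> = t * exp h + (1 - t)" by (simp add: exp_add[symmetric])
  finally show ?thesis by (simp add: algebra_simps)
qed

lemma qform_kron_diff:
  assumes "finite I"
  shows "qform I (\<lambda>i j. kron i j - N i j) x = dotp I x x - qform I N x"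
proof -
  have "qform I kron x = dotp I x x" by (rule dotp_cong) (simp_all add: kron_mvec[OF assms])
  then show ?thesis by (simp add: matrix_mvec_linear dotp_linear)
qed

text \<open>This is \<open>N\<^sup>2 \<le> N\<close>, from the identity
  \<open>N - N\<^sup>2 = N (1 - N) N + (1 - N) N (1 - N)\<close>.\<close>

lemma contraction_square_le:
  assumes N: "symm N" and N0: "\<And>x. 0 \<le> qform I N x" and N1: "\<And>x. qform I N x \<le> dotp I x x"
  shows "dotp I (mvec I N x) (mvec I N x) \<le> qform I N x"
proof -
  let ?y = "mvec I N x"
  have "0 \<le> (dotp I ?y ?y - qform I N ?y) + qform I N (\<lambda>i. x i - ?y i)"
    using N0[of "\<lambda>i. x i - ?y i"] N1[of ?y] by linarith
  also have "\<dots> = dotp I x ?y - dotp I ?y ?y"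
    using symm_mvec_swap[OF N, of I x ?y] by (simp add: mvec_linear dotp_linear)
  finally show ?thesis by simp
qed

text \<open>The parallelogram law, with the nonnegative form at \<open>y - z\<close>
  discarded.\<close>

lemma psd_qform_add_le:
  assumes "\<And>x. 0 \<le> qform I A x"
  shows "qform I A (\<lambda>i. y i + z i) \<le> 2 * qform I A y + 2 * qform I A z"
  using assms[of "\<lambda>i. y i - z i"] by (simp add: mvec_linear dotp_linear)

text \<open>Splitting \<open>x\<close> into \<open>N x\<close> and \<open>(1 - N) x\<close> gives
  \<open>A \<le> 2 N A N + 2 (1 - N)\<close>, since \<open>A \<le> 1\<close> and
  \<open>(1 - N)\<^sup>2 \<le> 1 - N\<close>. The term with \<open>B\<close> outweighs
  \<open>(2 \<theta> + 1) (1 - N)\<close>, so the exponent is at most the mean of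
  \<open>H + U\<close> and \<open>H + V\<close>. Convexity separates these and
  \<open>trexp_add_le\<close> linearises each.\<close>

lemma trexp_split_le:
  fixes \<theta> :: real
  assumes I: "finite I" and H: "symm H" "eigbasis I H w d"
    and A: "symm A" "\<And>x. 0 \<le> qform I A x" "\<And>x. qform I A x \<le> dotp I x x"
    and N: "symm N" "\<And>x. 0 \<le> qform I N x" "\<And>x. qform I N x \<le> dotp I x x"
    and B: "symm B" "\<And>x. dotp I x x - qform I N x \<le> \<kappa> * qform I B x"
    and \<theta>: "0 < \<theta>"
  shows "trexp I (\<lambda>i j. H i j + (\<theta> * A i j - \<kappa> * (2 * \<theta> + 1) * B i j))
    \<le> (\<Sum>k\<in>I. exp (d k) * (1 + (exp (4 * \<theta>) - 1) / 2 * qform I A (mvec I N (w k))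
          - (dotp I (w k) (w k) - qform I N (w k)) / 4))"
proof -
  \<comment> \<open>\<open>U\<close> and \<open>V\<close> are twice \<open>2 \<theta> N A N\<close>
    and \<open>-(1 - N)\<close>, because the midpoint inequality halves them.\<close>
  define U where "U = (\<lambda>i j. 4 * \<theta> * mmult I N (mmult I A N) i j)"
  define V where "V = (\<lambda>i j. (-2) * (kron i j - N i j))"
  have qU: "qform I U x = 4 * \<theta> * qform I A (mvec I N x)" for x
    unfolding U_def mscale_mvec mvec_mmult dotp_linear symm_mvec_swap[OF N(1), of I x] ..
  have qV: "qform I V x = -2 * (dotp I x x - qform I N x)" for x
    unfolding V_def mscale_mvec dotp_scale_right qform_kron_diff[OF I] ..
  have "symm (mmult I N (mmult I A N))"
    using A(1) N(1) by (simp add: symm_iff_mtransp mtransp_mmult mmult_assoc)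
  then have sU: "symm U" by (simp add: U_def symm_def)
  have sV: "symm V" using N(1) by (auto simp: V_def symm_def kron_def)
  have NN: "dotp I (mvec I N x) (mvec I N x) \<le> qform I N x" for x
    by (rule contraction_square_le[OF N])
  have le: "qform I (\<lambda>i j. H i j + (\<theta> * A i j - \<kappa> * (2 * \<theta> + 1) * B i j)) x
    \<le> (qform I (\<lambda>i j. H i j + U i j) x + qform I (\<lambda>i j. H i j + V i j) x) / 2" for x
  proof -
    let ?y = "mvec I N x"
    let ?z = "\<lambda>i. x i - mvec I N x i"
    have "qform I A (\<lambda>i. ?y i + ?z i) \<le> 2 * qform I A ?y + 2 * qform I A ?z"
      by (rule psd_qform_add_le[OF A(2)])
    then have 1: "qform I A x \<le> 2 * qform I A ?y + 2 * qform I A ?z" by simp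
    have "dotp I ?z ?z = dotp I x x - 2 * qform I N x + dotp I ?y ?y"
      unfolding dotp_linear using dotp_commute[of I ?y x] by simp
    then have 2: "qform I A ?z \<le> dotp I x x - qform I N x"
      using A(3)[of ?z] NN[of x] by linarith
    have 3: "\<theta> * qform I A x \<le> \<theta> * (2 * qform I A ?y + 2 * (dotp I x x - qform I N x))"
      using 1 2 \<theta> by (intro mult_left_mono) auto
    \<comment> \<open>Of the factor \<open>2 * \<theta> + 1\<close>, the part
      \<open>2 * \<theta>\<close> cancels the error of the splitting and the part 1 survives as
      \<open>-(1 - N)\<close>.\<close>
    have "(2 * \<theta> + 1) * (dotp I x x - qform I N x) \<le> (2 * \<theta> + 1) * (\<kappa> * qform I B x)"
      using B(2)[of x] \<theta> by (intro mult_left_mono) auto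
    with 3 have "\<theta> * qform I A x - \<kappa> * (2 * \<theta> + 1) * qform I B x
        \<le> (4 * \<theta> * qform I A ?y + (-2) * (dotp I x x - qform I N x)) / 2"
      by (simp add: algebra_simps)
    then show ?thesis
      unfolding madd_mvec dotp_add_right qU qV
      unfolding mdiff_mvec mscale_mvec dotp_linear by argo
  qed
  have s: "symm (\<lambda>i j. H i j + (\<theta> * A i j - \<kappa> * (2 * \<theta> + 1) * B i j))"
    "symm (\<lambda>i j. H i j + U i j)" "symm (\<lambda>i j. H i j + V i j)"
    using H(1) A(1) B(1) sU sV by (auto simp: symm_def)
  have "trexp I (\<lambda>i j. H i j + (\<theta> * A i j - \<kappa> * (2 * \<theta> + 1) * B i j))
      \<le> (trexp I (\<lambda>i j. H i j + U i j) + trexp I (\<lambda>i j. H i j + V i j)) / 2"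
    by (rule trexp_midpoint_le[OF I s le])
  also have "trexp I (\<lambda>i j. H i j + U i j)
      \<le> (\<Sum>k\<in>I. exp (d k) * (1 + (exp (4 * \<theta>) - 1) / (4 * \<theta>) * qform I U (w k)))"
  proof (rule trexp_add_le[OF I H sU, of 0 "4 * \<theta>"])
    fix x
    show "0 * dotp I x x \<le> qform I U x" using \<theta> A(2) by (simp add: qU)
    have "qform I A (mvec I N x) \<le> dotp I x x"
      using A(3)[of "mvec I N x"] NN[of x] N(3)[of x] by linarith
    then show "qform I U x \<le> 4 * \<theta> * dotp I x x" using \<theta> by (simp add: qU)
  next
    fix t assume "0 \<le> t" "t \<le> 4 * \<theta>"
    then show "exp t \<le> 1 + (exp (4 * \<theta>) - 1) / (4 * \<theta>) * t"
      using exp_chord[of "t / (4 * \<theta>)" "4 * \<theta>"] \<theta> by simp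
  qed
  also have "trexp I (\<lambda>i j. H i j + V i j)
      \<le> (\<Sum>k\<in>I. exp (d k) * (1 + (1/4) * qform I V (w k)))"
  proof (rule trexp_add_le[OF I H sV, of "-2" 0])
    fix x
    show "-2 * dotp I x x \<le> qform I V x" using N(2)[of x] by (simp add: qV)
    show "qform I V x \<le> 0 * dotp I x x" using N(3)[of x] by (simp add: qV)
  next
    fix t :: real assume t: "-2 \<le> t" "t \<le> 0"
    \<comment> \<open>The chord of \<open>exp\<close> over \<open>[-2, 0]\<close> has slope
      \<open>(1 - exp (-2)) / 2\<close>, which is at least \<open>1/4\<close>.\<close>
    have "3 \<le> exp (2::real)" using exp_ge_add_one_self[of 2] by simp
    then have e: "exp (-2) \<le> (1/2 :: real)" by (simp add: exp_minus field_simps)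
    have "exp t \<le> 1 + (exp (-2) - 1) * (- t / 2)"
      using exp_chord[of "- t / 2" "-2"] t by simp
    also have "\<dots> \<le> 1 + (1/2 - 1) * (- t / 2)" using e t by (intro add_left_mono mult_right_mono) auto
    finally show "exp t \<le> 1 + (1/4) * t" by simp
  qed
  finally have "trexp I (\<lambda>i j. H i j + (\<theta> * A i j - \<kappa> * (2 * \<theta> + 1) * B i j)) \<le>
     ((\<Sum>k\<in>I. exp (d k) * (1 + (exp (4 * \<theta>) - 1) / (4 * \<theta>) * qform I U (w k)))
      + (\<Sum>k\<in>I. exp (d k) * (1 + (1/4) * qform I V (w k)))) / 2" by simp
  also have "\<dots> = (\<Sum>k\<in>I. exp (d k) * (1 + (exp (4 * \<theta>) - 1) / 2 * qform I A (mvec I N (w k))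
          - (dotp I (w k) (w k) - qform I N (w k)) / 4))"
    unfolding sum.distrib[symmetric] sum_divide_distrib qU qV
    using \<theta> by (intro sum.cong refl) (simp add: field_simps)
  finally show ?thesis .
qed

text \<open>\<open>K\<close> is the inverse of \<open>1 + \<kappa> S\<close>, built in the
  eigenbasis of \<open>S\<close> with eigenvalues \<open>g = 1 / (1 + t)\<close>,
  \<open>t = \<kappa> l\<close>. The bounds reduce to \<open>0 \<le> g \<le> 1\<close> and
  \<open>1 - g = t g\<close>, which yields \<open>t g\<^sup>2 \<le> 1 - g \<le> t\<close>.\<close>

lemma resolvent_exists:
  fixes S :: "'a \<Rightarrow> 'a \<Rightarrow> real"
  assumes J: "finite J" and S: "symm S" "\<And>x. 0 \<le> qform J S x" and \<kappa>: "0 \<le> \<kappa>"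
  obtains K where "symm K" "\<And>x. 0 \<le> qform J K x" "\<And>x. qform J K x \<le> dotp J x x"
    "\<And>x. dotp J x x - qform J K x \<le> \<kappa> * qform J S x"
    "\<And>x. \<kappa> * qform J S (mvec J K x) \<le> dotp J x x - qform J K x"
proof -
  obtain u l where e: "eigbasis J S u l" using spectral_theorem[OF J S(1)] by blast
  have o: "onb J u" using e by (simp add: eigbasis_def)
  have l0: "0 \<le> l s" if "s \<in> J" for s using eigbasis_eigenvalue[OF e that] S(2) by simp
  define g where "g s = 1 / (1 + \<kappa> * l s)" for s
  define K where "K = (\<lambda>p q. \<Sum>s\<in>J. g s * u s p * u s q)"
  have sK: "symm K" by (simp add: K_def symm_def algebra_simps)
  have Kv: "mvec J K x = (\<lambda>p. \<Sum>s\<in>J. (g s * dotp J (u s) x) * u s p)" for x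
  proof
    fix p
    have "mvec J K x p = (\<Sum>q\<in>J. \<Sum>s\<in>J. g s * u s p * u s q * x q)"
      by (simp add: mvec_def K_def sum_distrib_right)
    also have "\<dots> = (\<Sum>s\<in>J. \<Sum>q\<in>J. g s * u s p * u s q * x q)" by (rule sum.swap)
    also have "\<dots> = (\<Sum>s\<in>J. (g s * dotp J (u s) x) * u s p)"
      by (simp add: dotp_def sum_distrib_left sum_distrib_right algebra_simps)
    finally show "mvec J K x p = (\<Sum>s\<in>J. (g s * dotp J (u s) x) * u s p)" .
  qed
  have qK: "qform J K x = (\<Sum>s\<in>J. g s * (dotp J (u s) x)\<^sup>2)" for x
    unfolding Kv dotp_linear by (simp add: power2_eq_square dotp_commute[of J x] mult.assoc)
  have n: "dotp J x x = (\<Sum>s\<in>J. (dotp J (u s) x)\<^sup>2)" for x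
    using onb_parseval[OF J o, of x x] by (simp add: power2_eq_square)
  have cK: "dotp J (u s) (mvec J K x) = g s * dotp J (u s) x" if "s \<in> J" for s x
  proof -
    have "dotp J (u s) (mvec J K x) = (\<Sum>t\<in>J. kron s t * (g t * dotp J (u t) x))"
      unfolding Kv dotp_linear using o that
      by (intro sum.cong) (auto simp: onb_def mult.commute)
    also have "\<dots> = g s * dotp J (u s) x"
      using kron_mvec[OF J that, of "\<lambda>t. g t * dotp J (u t) x"] by (simp add: mvec_def)
    finally show ?thesis .
  qed
  have qSK: "qform J S (mvec J K x) = (\<Sum>s\<in>J. l s * (g s * dotp J (u s) x)\<^sup>2)" for x
    unfolding eigbasis_qform[OF J S(1) e] by (simp add: cK)
  have g: "0 \<le> g s" "g s \<le> 1" "1 - g s \<le> \<kappa> * l s" "\<kappa> * l s * (g s)\<^sup>2 \<le> 1 - g s"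
    if "s \<in> J" for s
  proof -
    define t where "t = \<kappa> * l s"
    have t: "0 \<le> t" using l0[OF that] \<kappa> by (simp add: t_def)
    then show "0 \<le> g s" "g s \<le> 1" by (simp_all add: g_def t_def[symmetric])
    have g1: "1 - g s = t * g s" using t by (simp add: g_def t_def[symmetric] field_simps)
    show "1 - g s \<le> \<kappa> * l s"
      using g1 t \<open>g s \<le> 1\<close> mult_left_mono[of "g s" 1 t] by (simp add: t_def)
    have "t * (g s * g s) \<le> t * g s"
      using t \<open>0 \<le> g s\<close> \<open>g s \<le> 1\<close> mult_left_mono[of "g s" 1 "g s"] by (intro mult_left_mono) auto
    then show "\<kappa> * l s * (g s)\<^sup>2 \<le> 1 - g s"
      using g1 by (simp add: t_def power2_eq_square)
  qed
  show thesis
  proof (rule that[OF sK])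
    fix x
    show "0 \<le> qform J K x" unfolding qK using g by (intro sum_nonneg) auto
    show "qform J K x \<le> dotp J x x"
      unfolding qK n using g by (intro sum_mono mult_left_le_one_le) auto
    have d: "dotp J x x - qform J K x = (\<Sum>s\<in>J. (1 - g s) * (dotp J (u s) x)\<^sup>2)"
      unfolding qK n by (simp add: sum_subtractf[symmetric] algebra_simps)
    have "(\<Sum>s\<in>J. (1 - g s) * (dotp J (u s) x)\<^sup>2) \<le> (\<Sum>s\<in>J. \<kappa> * l s * (dotp J (u s) x)\<^sup>2)"
      using g by (intro sum_mono mult_right_mono) auto
    then show "dotp J x x - qform J K x \<le> \<kappa> * qform J S x"
      unfolding d eigbasis_qform[OF J S(1) e] by (simp add: sum_distrib_left mult.assoc)
    have "(\<Sum>s\<in>J. \<kappa> * l s * (g s)\<^sup>2 * (dotp J (u s) x)\<^sup>2) \<le> (\<Sum>s\<in>J. (1 - g s) * (dotp J (u s) x)\<^sup>2)"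
      using g by (intro sum_mono mult_right_mono) auto
    then show "\<kappa> * qform J S (mvec J K x) \<le> dotp J x x - qform J K x"
      unfolding d qSK by (simp add: sum_distrib_left mult.assoc power_mult_distrib)
  qed
qed

section \<open>Tensor products as vectors over pairs of indices\<close>

definition tensor :: "('a \<Rightarrow> real) \<Rightarrow> ('a \<Rightarrow> real) \<Rightarrow> 'a \<times> 'a \<Rightarrow> real" where
  "tensor u x = (\<lambda>p. u (fst p) * x (snd p))"

text \<open>The adjoint of \<open>\<lambda>x. tensor u x\<close>.\<close>

definition contract :: "'a set \<Rightarrow> ('a \<Rightarrow> real) \<Rightarrow> ('a \<times> 'a \<Rightarrow> real) \<Rightarrow> 'a \<Rightarrow> real" where
  "contract I u z = (\<lambda>i. \<Sum>a\<in>I. u a * z (a, i))"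

lemma dotp_tensor:
  "dotp (I \<times> I) (tensor u x) z = dotp I x (contract I u z)"
proof -
  have "dotp (I \<times> I) (tensor u x) z = (\<Sum>a\<in>I. \<Sum>i\<in>I. u a * x i * z (a, i))"
    by (simp add: dotp_def tensor_def sum.cartesian_product case_prod_beta)
  also have "\<dots> = (\<Sum>i\<in>I. \<Sum>a\<in>I. u a * x i * z (a, i))" by (rule sum.swap)
  also have "\<dots> = dotp I x (contract I u z)"
    by (simp add: dotp_def contract_def sum_distrib_left algebra_simps)
  finally show ?thesis .
qed

lemma contract_tensor: "contract I u (tensor v x) = (\<lambda>i. dotp I u v * x i)"
  by (simp add: contract_def tensor_def dotp_def sum_distrib_right mult.assoc)

lemma dotp_tensor_tensor:
  "dotp (I \<times> I) (tensor u x) (tensor v y) = dotp I u v * dotp I x y"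
  by (simp add: dotp_tensor contract_tensor dotp_linear)

text \<open>Lagrange's identity: sum the nonnegative forms at \<open>c f * y g - c g * y f\<close>
  over all pairs.\<close>

lemma psd_cauchy_schwarz_sum:
  assumes A: "symm A" "\<And>x. 0 \<le> qform I A x" and E: "finite E"
  shows "qform I A (\<lambda>i. \<Sum>f\<in>E. c f * y f i) \<le> (\<Sum>f\<in>E. (c f)\<^sup>2) * (\<Sum>f\<in>E. qform I A (y f))"
proof -
  let ?b = "\<lambda>f g. dotp I (y f) (mvec I A (y g))"
  have b: "?b f g = ?b g f" for f g using symm_mvec_swap[OF A(1)] dotp_commute by metis
  have "0 \<le> (\<Sum>f\<in>E. \<Sum>g\<in>E. qform I A (\<lambda>i. c f * y g i - c g * y f i))"
    by (intro sum_nonneg A)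
  also have "\<dots> = (\<Sum>f\<in>E. \<Sum>g\<in>E. (c f)\<^sup>2 * ?b g g) + (\<Sum>f\<in>E. \<Sum>g\<in>E. (c g)\<^sup>2 * ?b f f)
      - 2 * (\<Sum>f\<in>E. \<Sum>g\<in>E. c f * c g * ?b f g)"
    unfolding mvec_linear dotp_linear
    by (simp add: b[of _ _] power2_eq_square sum.distrib sum_subtractf sum_distrib_left algebra_simps)
  also have "(\<Sum>f\<in>E. \<Sum>g\<in>E. (c g)\<^sup>2 * ?b f f) = (\<Sum>f\<in>E. \<Sum>g\<in>E. (c f)\<^sup>2 * ?b g g)"
    by (rule sum.swap)
  also have "(\<Sum>f\<in>E. \<Sum>g\<in>E. (c f)\<^sup>2 * ?b g g) = (\<Sum>f\<in>E. (c f)\<^sup>2) * (\<Sum>f\<in>E. qform I A (y f))"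
    by (simp add: sum_product)
  also have "(\<Sum>f\<in>E. \<Sum>g\<in>E. c f * c g * ?b f g) = qform I A (\<lambda>i. \<Sum>f\<in>E. c f * y f i)"
    unfolding mvec_linear dotp_linear
    by (subst sum.swap) (simp add: sum_distrib_left algebra_simps)
  finally show ?thesis by simp
qed

lemma contract_linear: "contract I u (\<lambda>p. \<Sum>f\<in>E. c f * y f p) = (\<lambda>i. \<Sum>f\<in>E. c f * contract I u (y f) i)"
proof
  fix i
  have "contract I u (\<lambda>p. \<Sum>f\<in>E. c f * y f p) i = (\<Sum>a\<in>I. \<Sum>f\<in>E. u a * (c f * y f (a, i)))"
    by (simp add: contract_def sum_distrib_left)
  also have "\<dots> = (\<Sum>f\<in>E. \<Sum>a\<in>I. u a * (c f * y f (a, i)))" by (rule sum.swap)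
  also have "\<dots> = (\<Sum>f\<in>E. c f * contract I u (y f) i)"
    by (simp add: contract_def sum_distrib_left algebra_simps)
  finally show "contract I u (\<lambda>p. \<Sum>f\<in>E. c f * y f p) i = (\<Sum>f\<in>E. c f * contract I u (y f) i)" .
qed

text \<open>One greedy step. In the application \<open>u e = P v\<^sub>e\<close>, \<open>s e\<close>
  is the selection weight, \<open>B e\<close> is \<open>L(Q\<^sub>e)\<close>, and \<open>H\<close>
  is the exponent of the current potential. The \<open>\<kappa>\<close> here is the resolvent
  parameter; \<open>\<kappa> * (2 * \<theta> + 1)\<close> is the \<open>\<kappa>'\<close> of the
  introduction.\<close>

theorem expected_trexp_le:
  fixes A :: "'e \<Rightarrow> 'a \<Rightarrow> 'a \<Rightarrow> real" and u :: "'e \<Rightarrow> 'a \<Rightarrow> real" and \<theta> :: real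
  assumes I: "finite I" and E: "finite E"
    and A: "\<And>e. e \<in> E \<Longrightarrow> symm (A e)" "\<And>e x. e \<in> E \<Longrightarrow> 0 \<le> qform I (A e) x"
      "\<And>e x. e \<in> E \<Longrightarrow> qform I (A e) x \<le> dotp I x x"
    and frame: "\<And>e i. e \<in> E \<Longrightarrow> i \<in> I \<Longrightarrow> u e i = (\<Sum>f\<in>E. dotp I (u f) (u e) * u f i)"
    and H: "symm H" and \<theta>: "0 < \<theta>"
  defines "\<kappa> \<equiv> 2 * (exp (4 * \<theta>) - 1)"
  defines "s \<equiv> \<lambda>e. dotp I (u e) (u e)"
  defines "B \<equiv> \<lambda>e i j. \<Sum>f\<in>E. (dotp I (u f) (u e))\<^sup>2 / s e * A f i j"
  shows "(\<Sum>e\<in>E. s e * trexp I (\<lambda>i j. H i j + (\<theta> * A e i j - \<kappa> * (2 * \<theta> + 1) * B e i j)))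
    \<le> (\<Sum>e\<in>E. s e) * trexp I H"
proof -
  let ?T = "I \<times> I"
  have T: "finite ?T" using I by simp
  have \<kappa>0: "0 \<le> \<kappa>" using \<theta> by (simp add: \<kappa>_def)
  \<comment> \<open>The operator \<open>\<Sum>\<^sub>e u\<^sub>e u\<^sub>e\<^sup>T \<otimes>
    A\<^sub>e\<close>. Its compression to tensors with first factor \<open>u e\<close> is
    \<open>s e\<close> times \<open>B e\<close>; see \<open>qB\<close>.\<close>
  define L where "L = (\<lambda>p q. \<Sum>e\<in>E. u e (fst p) * u e (fst q) * A e (snd p) (snd q))"
  have sL: "symm L" unfolding symm_def L_def
    using A(1) by (intro allI sum.cong) (auto simp: symm_def mult.commute)
  have mL: "mvec ?T L z = (\<lambda>p. \<Sum>e\<in>E. tensor (u e) (mvec I (A e) (contract I (u e) z)) p)" for z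
  proof
    fix p
    have "mvec ?T L z p = (\<Sum>q\<in>?T. \<Sum>e\<in>E. u e (fst p) * u e (fst q) * A e (snd p) (snd q) * z q)"
      by (simp add: mvec_def L_def sum_distrib_right)
    also have "\<dots> = (\<Sum>e\<in>E. \<Sum>q\<in>?T. u e (fst p) * u e (fst q) * A e (snd p) (snd q) * z q)"
      by (rule sum.swap)
    also have "\<dots> = (\<Sum>e\<in>E. u e (fst p) * dotp ?T (tensor (u e) (A e (snd p))) z)"
      by (simp add: dotp_def tensor_def sum_distrib_left mult.assoc)
    also have "\<dots> = (\<Sum>e\<in>E. tensor (u e) (mvec I (A e) (contract I (u e) z)) p)"
      unfolding dotp_tensor by (simp add: tensor_def mvec_def dotp_def)
    finally show "mvec ?T L z p = (\<Sum>e\<in>E. tensor (u e) (mvec I (A e) (contract I (u e) z)) p)" .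
  qed
  have qL: "qform ?T L z = (\<Sum>e\<in>E. qform I (A e) (contract I (u e) z))" for z
    unfolding mL dotp_sum_right
    by (simp add: dotp_commute[of ?T z] dotp_tensor dotp_commute[of I "mvec _ _ _"])
  have L0: "0 \<le> qform ?T L z" for z unfolding qL by (intro sum_nonneg A)
  obtain K where sK: "symm K" and K0: "\<And>x. 0 \<le> qform ?T K x"
    and K1: "\<And>x. qform ?T K x \<le> dotp ?T x x"
    and K2: "\<And>x. dotp ?T x x - qform ?T K x \<le> \<kappa> * qform ?T L x"
    and K3: "\<And>x. \<kappa> * qform ?T L (mvec ?T K x) \<le> dotp ?T x x - qform ?T K x"
    using resolvent_exists[OF T sL L0 \<kappa>0] by blast
  define N where "N = (\<lambda>e i j. (\<Sum>a\<in>I. \<Sum>b\<in>I. u e a * u e b * K (a, i) (b, j)) / s e)"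
  have sN: "symm (N e)" for e
  proof -
    have "(\<Sum>a\<in>I. \<Sum>b\<in>I. u e a * u e b * K (a, i) (b, j))
        = (\<Sum>a\<in>I. \<Sum>b\<in>I. u e a * u e b * K (a, j) (b, i))" for i j
    proof -
      have "(\<Sum>a\<in>I. \<Sum>b\<in>I. u e a * u e b * K (a, i) (b, j))
          = (\<Sum>b\<in>I. \<Sum>a\<in>I. u e a * u e b * K (a, i) (b, j))" by (rule sum.swap)
      also have "\<dots> = (\<Sum>b\<in>I. \<Sum>a\<in>I. u e b * u e a * K (b, j) (a, i))"
        using sK by (intro sum.cong refl) (auto simp: symm_def mult.commute)
      finally show ?thesis .
    qed
    then show ?thesis by (simp add: symm_def N_def)
  qed
  have mN: "mvec I (N e) x = (\<lambda>i. (1 / s e) * contract I (u e) (mvec ?T K (tensor (u e) x)) i)" for e x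
  proof
    fix i
    have "contract I (u e) (mvec ?T K (tensor (u e) x)) i
        = (\<Sum>a\<in>I. \<Sum>b\<in>I. \<Sum>j\<in>I. u e a * u e b * K (a, i) (b, j) * x j)"
      by (simp add: contract_def mvec_def tensor_def sum_distrib_left sum.cartesian_product
          case_prod_beta algebra_simps)
    also have "\<dots> = (\<Sum>a\<in>I. \<Sum>j\<in>I. \<Sum>b\<in>I. u e a * u e b * K (a, i) (b, j) * x j)"
      by (rule sum.cong[OF refl], rule sum.swap)
    also have "\<dots> = (\<Sum>j\<in>I. \<Sum>a\<in>I. \<Sum>b\<in>I. u e a * u e b * K (a, i) (b, j) * x j)"
      by (rule sum.swap)
    finally show "mvec I (N e) x i = (1 / s e) * contract I (u e) (mvec ?T K (tensor (u e) x)) i"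
      by (simp add: mvec_def N_def sum_distrib_right sum_divide_distrib)
  qed
  have qN: "qform I (N e) x = (1 / s e) * qform ?T K (tensor (u e) x)" for e x
    unfolding mN dotp_scale_right dotp_tensor[symmetric] ..
  have tt: "dotp ?T (tensor (u e) x) (tensor (u e) x) = s e * dotp I x x" for e x
    by (simp add: dotp_tensor_tensor s_def)
  have s0: "0 \<le> s e" for e unfolding s_def by (rule dotp_self_nonneg)
  have sg: "s e = (\<Sum>f\<in>E. (dotp I (u f) (u e))\<^sup>2)" if "e \<in> E" for e
  proof -
    have "s e = dotp I (\<lambda>i. \<Sum>f\<in>E. dotp I (u f) (u e) * u f i) (u e)"
      unfolding s_def by (rule dotp_cong[OF frame[OF that] refl])
    then show ?thesis by (simp add: dotp_linear power2_eq_square)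
  qed
  have qB: "qform I (B e) x = (1 / s e) * qform ?T L (tensor (u e) x)" for e x
    unfolding qL contract_tensor mvec_scale dotp_scale_left dotp_scale_right B_def
      matrix_mvec_linear dotp_sum_right
    by (simp add: sum_distrib_left power2_eq_square mult.assoc)
  have sB: "symm (B e)" for e unfolding symm_def B_def
    using A(1) by (intro allI sum.cong) (auto simp: symm_def)
  \<comment> \<open>Where \<open>s e = 0\<close>, division by zero makes \<open>N e\<close> and
    \<open>B e\<close> vanish, and the comparison \<open>N2\<close> can fail. Such \<open>e\<close>
    carry no weight.\<close>
  define E' where "E' = {e \<in> E. 0 < s e}"
  have E': "E' \<subseteq> E" "finite E'" using E by (auto simp: E'_def)
  have restrict: "(\<Sum>e\<in>E. s e * F e) = (\<Sum>e\<in>E'. s e * F e)" for F :: "'e \<Rightarrow> real"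
    using E s0 by (intro sum.mono_neutral_right) (auto simp: E'_def less_le)
  have N0: "0 \<le> qform I (N e) x" for e x unfolding qN using K0 s0 by simp
  have N1: "qform I (N e) x \<le> dotp I x x" if "e \<in> E'" for e x
    using that K1[of "tensor (u e) x"] unfolding qN tt by (simp add: E'_def field_simps)
  have N2: "dotp I x x - qform I (N e) x \<le> \<kappa> * qform I (B e) x" if "e \<in> E'" for e x
  proof -
    have pos: "0 < s e" using that by (simp add: E'_def)
    then have "(1 / s e) * (s e * dotp I x x - qform ?T K (tensor (u e) x))
        \<le> (1 / s e) * (\<kappa> * qform ?T L (tensor (u e) x))"
      using K2[of "tensor (u e) x"] unfolding tt by (intro mult_left_mono) auto
    then show ?thesis unfolding qN qB using pos by (simp add: right_diff_distrib)
  qed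
  \<comment> \<open>The cancellation on average. Each form at \<open>N e x\<close> is bounded by a
    sum over \<open>f\<close> of forms at the vectors \<open>y f\<close>; summed over
    \<open>e\<close> this is a sum of forms of \<open>L\<close> at resolvent vectors, to which
    \<open>K3\<close> applies.\<close>
  have main: "\<kappa> * (\<Sum>e\<in>E'. s e * qform I (A e) (mvec I (N e) x))
      \<le> (\<Sum>e\<in>E'. s e * (dotp I x x - qform I (N e) x))" for x
  proof -
    define y where "y f = mvec ?T K (tensor (u f) x)" for f
    have ye: "y e = (\<lambda>p. \<Sum>f\<in>E. dotp I (u f) (u e) * y f p)" if e: "e \<in> E" for e
    proof -
      have "y e = mvec ?T K (\<lambda>p. \<Sum>f\<in>E. dotp I (u f) (u e) * tensor (u f) x p)"
        unfolding y_def
      proof (rule mvec_cong)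
        fix p assume "p \<in> ?T"
        then have "u e (fst p) = (\<Sum>f\<in>E. dotp I (u f) (u e) * u f (fst p))"
          using frame[OF e, of "fst p"] by auto
        then show "tensor (u e) x p = (\<Sum>f\<in>E. dotp I (u f) (u e) * tensor (u f) x p)"
          unfolding tensor_def by (simp add: sum_distrib_right mult.assoc)
      qed
      then show ?thesis unfolding mvec_linear y_def .
    qed
    \<comment> \<open>The frame identity expands \<open>y e\<close> in the \<open>y f\<close>. The
      squared coefficients add up to \<open>s e\<close> by \<open>sg\<close>, so Cauchy-Schwarz
      yields a factor \<open>s e\<close> that compensates the normalisation of
      \<open>N e\<close>.\<close>
    have step: "s e * qform I (A e) (mvec I (N e) x) \<le> (\<Sum>f\<in>E. qform I (A e) (contract I (u e) (y f)))"
      if e: "e \<in> E'" for e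
    proof -
      have eE: "e \<in> E" and pos: "0 < s e" using e by (auto simp: E'_def)
      have "contract I (u e) (y e)
          = (\<lambda>i. \<Sum>f\<in>E. dotp I (u f) (u e) * contract I (u e) (y f) i)"
        using arg_cong[OF ye[OF eE], of "contract I (u e)"] by (simp only: contract_linear)
      then have "qform I (A e) (contract I (u e) (y e))
          = qform I (A e) (\<lambda>i. \<Sum>f\<in>E. dotp I (u f) (u e) * contract I (u e) (y f) i)"
        by (rule arg_cong)
      also have "\<dots> \<le> (\<Sum>f\<in>E. (dotp I (u f) (u e))\<^sup>2) * (\<Sum>f\<in>E. qform I (A e) (contract I (u e) (y f)))"
        by (rule psd_cauchy_schwarz_sum[OF A(1)[OF eE] A(2)[OF eE] E])
      also have "\<dots> = s e * (\<Sum>f\<in>E. qform I (A e) (contract I (u e) (y f)))"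
        by (simp add: sg[OF eE])
      finally have le: "qform I (A e) (contract I (u e) (y e))
          \<le> s e * (\<Sum>f\<in>E. qform I (A e) (contract I (u e) (y f)))" .
      have "s e * qform I (A e) (mvec I (N e) x) = (1 / s e) * qform I (A e) (contract I (u e) (y e))"
        unfolding mN mvec_scale dotp_linear y_def[symmetric] using pos by simp
      also have "\<dots> \<le> (1 / s e) * (s e * (\<Sum>f\<in>E. qform I (A e) (contract I (u e) (y f))))"
        using le pos by (intro mult_left_mono) auto
      also have "\<dots> = (\<Sum>f\<in>E. qform I (A e) (contract I (u e) (y f)))" using pos by simp
      finally show ?thesis .
    qed
    have "(\<Sum>e\<in>E'. s e * qform I (A e) (mvec I (N e) x))
        \<le> (\<Sum>e\<in>E'. \<Sum>f\<in>E. qform I (A e) (contract I (u e) (y f)))"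
      by (intro sum_mono step)
    also have "\<dots> \<le> (\<Sum>e\<in>E. \<Sum>f\<in>E. qform I (A e) (contract I (u e) (y f)))"
      using E' E A(2) by (intro sum_mono2 sum_nonneg) auto
    also have "\<dots> = (\<Sum>f\<in>E. \<Sum>e\<in>E. qform I (A e) (contract I (u e) (y f)))" by (rule sum.swap)
    also have "\<dots> = (\<Sum>f\<in>E. qform ?T L (y f))" by (simp add: qL)
    finally have "\<kappa> * (\<Sum>e\<in>E'. s e * qform I (A e) (mvec I (N e) x)) \<le> \<kappa> * (\<Sum>f\<in>E. qform ?T L (y f))"
      using \<kappa>0 by (rule mult_left_mono)
    also have "\<dots> \<le> (\<Sum>f\<in>E. s f * dotp I x x - qform ?T K (tensor (u f) x))"
      unfolding sum_distrib_left y_def tt[symmetric] by (intro sum_mono K3)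
    \<comment> \<open>A term with \<open>s f = 0\<close> is minus a nonnegative form of
      \<open>K\<close>, so dropping it can only increase the sum.\<close>
    also have "\<dots> \<le> (\<Sum>f\<in>E'. s f * dotp I x x - qform ?T K (tensor (u f) x))"
    proof -
      have "(\<Sum>f\<in>E. s f * dotp I x x - qform ?T K (tensor (u f) x))
          = (\<Sum>f\<in>E'. s f * dotp I x x - qform ?T K (tensor (u f) x))
          + (\<Sum>f\<in>E - E'. s f * dotp I x x - qform ?T K (tensor (u f) x))"
        by (subst sum.subset_diff[OF E'(1) E]) (rule add.commute)
      moreover have "(\<Sum>f\<in>E - E'. s f * dotp I x x - qform ?T K (tensor (u f) x)) \<le> 0"
      proof (rule sum_nonpos)
        fix f assume "f \<in> E - E'"
        then have "s f = 0" using s0[of f] by (auto simp: E'_def)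
        then show "s f * dotp I x x - qform ?T K (tensor (u f) x) \<le> 0" using K0 by simp
      qed
      ultimately show ?thesis by linarith
    qed
    also have "\<dots> = (\<Sum>f\<in>E'. s f * (dotp I x x - qform I (N f) x))"
      unfolding qN by (intro sum.cong refl) (auto simp: E'_def field_simps)
    finally show ?thesis .
  qed
  obtain w d where e: "eigbasis I H w d" and t: "trexp I H = (\<Sum>k\<in>I. exp (d k))"
    using trexp_eigbasis[OF I H] .
  let ?a = "\<lambda>e k. qform I (A e) (mvec I (N e) (w k))"
  let ?c = "\<lambda>e k. dotp I (w k) (w k) - qform I (N e) (w k)"
  have "(\<Sum>e\<in>E. s e * trexp I (\<lambda>i j. H i j + (\<theta> * A e i j - \<kappa> * (2 * \<theta> + 1) * B e i j)))
      = (\<Sum>e\<in>E'. s e * trexp I (\<lambda>i j. H i j + (\<theta> * A e i j - \<kappa> * (2 * \<theta> + 1) * B e i j)))"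
    by (rule restrict)
  also have "\<dots> \<le> (\<Sum>e\<in>E'. s e * (\<Sum>k\<in>I. exp (d k) * (1 + (exp (4 * \<theta>) - 1) / 2 * ?a e k - ?c e k / 4)))"
    using E' s0 A N0 N1 N2 sN sB
    by (intro sum_mono mult_left_mono trexp_split_le[OF I H e _ _ _ _ _ _ _ _ \<theta>]) auto
  \<comment> \<open>The value of \<open>\<kappa>\<close> makes
    \<open>(exp (4 * \<theta>) - 1) / 2\<close> equal to \<open>\<kappa> / 4\<close>, so both
    correction terms share the factor \<open>1/4\<close> and \<open>main\<close> applies.\<close>
  also have "\<dots> = (\<Sum>e\<in>E'. \<Sum>k\<in>I. exp (d k) * (s e + (\<kappa> * (s e * ?a e k) - s e * ?c e k) / 4))"
    unfolding sum_distrib_left by (intro sum.cong refl) (simp add: \<kappa>_def field_simps)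
  also have "\<dots> = (\<Sum>k\<in>I. \<Sum>e\<in>E'. exp (d k) * (s e + (\<kappa> * (s e * ?a e k) - s e * ?c e k) / 4))"
    by (rule sum.swap)
  also have "\<dots> = (\<Sum>k\<in>I. exp (d k) * ((\<Sum>e\<in>E'. s e)
      + (\<kappa> * (\<Sum>e\<in>E'. s e * ?a e k) - (\<Sum>e\<in>E'. s e * ?c e k)) / 4))"
    by (simp add: sum_distrib_left[symmetric] sum.distrib sum_divide_distrib[symmetric] sum_subtractf)
  also have "\<dots> \<le> (\<Sum>k\<in>I. exp (d k) * (\<Sum>e\<in>E'. s e))"
    using main by (intro sum_mono mult_left_mono) (auto simp: diff_le_eq)
  also have "\<dots> = (\<Sum>e\<in>E'. s e) * trexp I H" unfolding t sum_distrib_right[symmetric] by (rule mult.commute)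
  also have "(\<Sum>e\<in>E'. s e) = (\<Sum>e\<in>E. s e)" using restrict[of "\<lambda>_. 1"] by simp
  finally show ?thesis .
qed

section \<open>Greedy selection of a basis\<close>

text \<open>Apply the reconstruction formula to the coordinate vector \<open>kron i\<close>.\<close>

lemma frame_kron:
  assumes I: "finite I" and pars: "\<And>x i. i \<in> I \<Longrightarrow> x i = (\<Sum>e\<in>E. dotp I (v e) x * v e i)"
    and ij: "i \<in> I" "j \<in> I"
  shows "(\<Sum>e\<in>E. v e i * v e j) = kron i j"
proof -
  have "dotp I (v e) (kron i) = v e i" for e
    using kron_mvec[OF I ij(1), of "v e"] by (simp add: dotp_def mvec_def mult.commute)
  then show ?thesis using pars[OF ij(2), of "kron i"] by simp
qed

text \<open>For a projection \<open>P\<close> this says that the selection weights add up to the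
  dimension that is left.\<close>

lemma frame_trace:
  assumes I: "finite I" and pars: "\<And>x i. i \<in> I \<Longrightarrow> x i = (\<Sum>e\<in>E. dotp I (v e) x * v e i)"
  shows "(\<Sum>e\<in>E. qform I P (v e)) = mtr I P"
proof -
  have "(\<Sum>e\<in>E. qform I P (v e)) = (\<Sum>e\<in>E. \<Sum>i\<in>I. \<Sum>j\<in>I. P i j * (v e i * v e j))"
    by (simp add: dotp_def mvec_def sum_distrib_left algebra_simps)
  also have "\<dots> = (\<Sum>i\<in>I. \<Sum>e\<in>E. \<Sum>j\<in>I. P i j * (v e i * v e j))" by (rule sum.swap)
  also have "\<dots> = (\<Sum>i\<in>I. \<Sum>j\<in>I. \<Sum>e\<in>E. P i j * (v e i * v e j))"
    by (rule sum.cong[OF refl], rule sum.swap)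
  also have "\<dots> = (\<Sum>i\<in>I. \<Sum>j\<in>I. kron i j * P i j)"
    using frame_kron[OF I pars] by (simp add: sum_distrib_left[symmetric] mult.commute)
  also have "\<dots> = (\<Sum>i\<in>I. P i i)"
    using kron_mvec[OF I, of _ "P _"] by (intro sum.cong) (auto simp: mvec_def)
  finally show ?thesis by (simp add: mtr_def)
qed

text \<open>Summing over a list adds exactly one term per greedy step, with no distinctness
  argument.\<close>

definition msum_list :: "('e \<Rightarrow> 'a \<Rightarrow> 'a \<Rightarrow> real) \<Rightarrow> 'e list \<Rightarrow> 'a \<Rightarrow> 'a \<Rightarrow> real" where
  "msum_list A F = (\<lambda>i j. \<Sum>e\<leftarrow>F. A e i j)"

lemma qform_msum_list: "qform I (msum_list A F) x = (\<Sum>e\<leftarrow>F. qform I (A e) x)"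
proof (induction F)
  case Nil
  then show ?case by (simp add: msum_list_def mvec_def dotp_def)
next
  case (Cons e F)
  have "msum_list A (e # F) = (\<lambda>i j. A e i j + msum_list A F i j)" by (simp add: msum_list_def)
  then show ?case using Cons by (simp add: madd_mvec dotp_linear)
qed

lemma symm_msum_list: "(\<And>e. e \<in> set F \<Longrightarrow> symm (A e)) \<Longrightarrow> symm (msum_list A F)"
  unfolding symm_def msum_list_def by (intro allI arg_cong[of _ _ sum_list] map_cong) auto

text \<open>The map \<open>P \<mapsto> L(P)\<close> of the introduction.\<close>

definition compress :: "'a set \<Rightarrow> 'e set \<Rightarrow> ('e \<Rightarrow> 'a \<Rightarrow> real) \<Rightarrow> ('e \<Rightarrow> 'a \<Rightarrow> 'a \<Rightarrow> real) \<Rightarrow>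
    ('a \<Rightarrow> 'a \<Rightarrow> real) \<Rightarrow> 'a \<Rightarrow> 'a \<Rightarrow> real" where
  "compress I E v A P = (\<lambda>i j. \<Sum>e\<in>E. qform I P (v e) * A e i j)"

lemma qform_compress: "qform I (compress I E v A P) x = (\<Sum>e\<in>E. qform I P (v e) * qform I (A e) x)"
  unfolding compress_def matrix_mvec_linear dotp_linear ..

text \<open>Replaces random selection by the choice of an outcome no worse than the mean. Its weight
  is positive, so the next projection may divide by it.\<close>

lemma weighted_mean_le_exists:
  fixes s t :: "'e \<Rightarrow> real"
  assumes "finite E" "\<And>e. e \<in> E \<Longrightarrow> 0 \<le> s e" "0 < (\<Sum>e\<in>E. s e)"
    "(\<Sum>e\<in>E. s e * t e) \<le> (\<Sum>e\<in>E. s e) * c"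
  shows "\<exists>e\<in>E. 0 < s e \<and> t e \<le> c"
proof (rule ccontr)
  assume neg: "\<not> ?thesis"
  have "(\<Sum>e\<in>E. s e * c) < (\<Sum>e\<in>E. s e * t e)"
  proof (rule sum_strict_mono_ex1[OF assms(1)])
    show "\<forall>e\<in>E. s e * c \<le> s e * t e"
    proof
      fix e assume e: "e \<in> E"
      show "s e * c \<le> s e * t e"
        using neg assms(2)[OF e] e by (cases "s e = 0") (auto intro!: mult_left_mono simp: less_le)
    qed
    obtain e where e: "e \<in> E" "0 < s e"
      using assms(3) by (meson not_le sum_nonpos)
    then show "\<exists>e\<in>E. s e * c < s e * t e" using neg by (intro bexI[of _ e]) auto
  qed
  then show False using assms(4) by (simp add: sum_distrib_right)
qed

text \<open>After \<open>card I\<close> greedy steps the remaining projection has trace zero and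
  vanishes. It also fixes every vector orthogonal to the chosen \<open>v e\<close>, so only zero is
  orthogonal to all of them. The potential never exceeded its initial value.\<close>

theorem exists_basis_small_trexp:
  fixes A :: "'e \<Rightarrow> 'a \<Rightarrow> 'a \<Rightarrow> real" and v :: "'e \<Rightarrow> 'a \<Rightarrow> real" and \<theta> :: real
  assumes I: "finite I" and E: "finite E"
    and A: "\<And>e. e \<in> E \<Longrightarrow> symm (A e)" "\<And>e x. e \<in> E \<Longrightarrow> 0 \<le> qform I (A e) x"
      "\<And>e x. e \<in> E \<Longrightarrow> qform I (A e) x \<le> dotp I x x"
    and pars: "\<And>x i. i \<in> I \<Longrightarrow> x i = (\<Sum>e\<in>E. dotp I (v e) x * v e i)"
    and iso: "\<And>x. (\<Sum>e\<in>E. dotp I (v e) (v e) * qform I (A e) x) = dotp I x x"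
    and \<theta>: "0 < \<theta>"
  defines "\<kappa> \<equiv> 2 * (exp (4 * \<theta>) - 1) * (2 * \<theta> + 1)"
  shows "\<exists>F. length F = card I \<and> set F \<subseteq> E \<and>
    (\<forall>x. (\<forall>e\<in>set F. dotp I (v e) x = 0) \<longrightarrow> (\<forall>i\<in>I. x i = 0)) \<and>
    trexp I (\<lambda>i j. \<theta> * msum_list A F i j) \<le> real (card I) * exp \<kappa>"
proof -
  have \<kappa>0: "0 \<le> \<kappa>" using \<theta> by (simp add: \<kappa>_def)
  let ?L = "compress I E v A"
  have sL: "symm (?L P)" for P
    unfolding symm_def compress_def using A(1) by (intro allI sum.cong) (auto simp: symm_def)
  \<comment> \<open>\<open>P\<close> is an orthogonal projection by symmetry and idempotence. Its
    trace counts the steps still to come, and its range contains the orthogonal complement of the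
    chosen vectors.\<close>
  let ?Inv = "\<lambda>k F P. length F = k \<and> set F \<subseteq> E \<and> symm P \<and>
    (\<forall>x. \<forall>i\<in>I. mvec I P (mvec I P x) i = mvec I P x i) \<and>
    mtr I P = real (card I) - real k \<and>
    (\<forall>x. (\<forall>e\<in>set F. dotp I (v e) x = 0) \<longrightarrow> (\<forall>i\<in>I. mvec I P x i = x i)) \<and>
    trexp I (\<lambda>i j. \<theta> * msum_list A F i j + \<kappa> * ?L P i j) \<le> real (card I) * exp \<kappa>"
  have "k \<le> card I \<Longrightarrow> \<exists>F P. ?Inv k F P" for k
  proof (induction k)
    case 0
    have q: "qform I kron x = dotp I x x" for x
      by (rule dotp_cong) (simp_all add: kron_mvec[OF I])
    \<comment> \<open>At the start \<open>P\<close> is the unit matrix, and \<open>iso\<close> gives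
      \<open>L(I) = I\<close>, so the exponent is the scalar \<open>\<kappa>\<close>.\<close>
    have "trexp I (\<lambda>i j. \<theta> * msum_list A [] i j + \<kappa> * ?L kron i j) = real (card I) * exp \<kappa>"
    proof (rule trexp_scalar[OF I])
      show "symm (\<lambda>i j. \<theta> * msum_list A [] i j + \<kappa> * ?L kron i j)"
        using sL[of kron] by (simp add: symm_def msum_list_def)
      show "qform I (\<lambda>i j. \<theta> * msum_list A [] i j + \<kappa> * ?L kron i j) x = \<kappa> * dotp I x x" for x
        unfolding madd_mvec mscale_mvec dotp_linear qform_msum_list qform_compress q iso by simp
    qed
    moreover have "symm kron" by (auto simp: symm_def kron_def)
    moreover have "mtr I kron = real (card I)" by (simp add: mtr_def kron_def)
    ultimately have "?Inv 0 [] kron"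
      by (auto simp: kron_mvec[OF I])
    then show ?case by blast
  next
    case (Suc k)
    then obtain F P where len: "length F = k" and F: "set F \<subseteq> E" and sP: "symm P"
      and PP: "\<And>x i. i \<in> I \<Longrightarrow> mvec I P (mvec I P x) i = mvec I P x i"
      and trP: "mtr I P = real (card I) - real k"
      and ker: "\<And>x i. (\<And>e. e \<in> set F \<Longrightarrow> dotp I (v e) x = 0) \<Longrightarrow> i \<in> I \<Longrightarrow> mvec I P x i = x i"
      and pot: "trexp I (\<lambda>i j. \<theta> * msum_list A F i j + \<kappa> * ?L P i j) \<le> real (card I) * exp \<kappa>"
      by auto
    define u where "u e = mvec I P (v e)" for e
    define s where "s e = dotp I (u e) (u e)" for e
    have uP: "dotp I (u e) (mvec I P x) = dotp I (u e) x" for e x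
    proof -
      have "dotp I (u e) (mvec I P x) = dotp I (mvec I P (u e)) x" by (rule symm_mvec_swap[OF sP])
      also have "\<dots> = dotp I (u e) x" by (rule dotp_cong) (simp_all add: u_def PP)
      finally show ?thesis .
    qed
    have uv: "dotp I (u f) x = dotp I (v f) (mvec I P x)" for f x
      unfolding u_def by (rule symm_mvec_swap[OF sP, symmetric])
    have uu: "dotp I (v f) (u e) = dotp I (u f) (u e)" for e f
      using uv[of f "v e"] uP[of f "v e"] by (simp add: u_def[symmetric])
    have frame: "u e i = (\<Sum>f\<in>E. dotp I (u f) (u e) * u f i)" if i: "i \<in> I" for e i
    proof -
      have "u e i = mvec I P (u e) i" using PP[OF i, of "v e"] by (simp add: u_def)
      also have "mvec I P (u e) = mvec I P (\<lambda>j. \<Sum>f\<in>E. dotp I (v f) (u e) * v f j)"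
        by (rule mvec_cong, rule pars)
      also have "\<dots> = (\<lambda>i. \<Sum>f\<in>E. dotp I (u f) (u e) * u f i)"
        unfolding mvec_linear uu u_def[symmetric] ..
      finally show ?thesis .
    qed
    have qP: "qform I P (v e) = s e" for e using uu[of e e] by (simp add: s_def u_def)
    have "(\<Sum>e\<in>E. s e) = mtr I P" using frame_trace[OF I pars, of P] by (simp add: qP)
    then have pos: "0 < (\<Sum>e\<in>E. s e)" using trP Suc.prems by simp
    define H where "H = (\<lambda>i j. \<theta> * msum_list A F i j + \<kappa> * ?L P i j)"
    have "symm (msum_list A F)" using A(1) F by (intro symm_msum_list) auto
    then have sH: "symm H" using sL[of P] by (simp add: H_def symm_def)
    define B where "B e = (\<lambda>i j. \<Sum>f\<in>E. (dotp I (u f) (u e))\<^sup>2 / s e * A f i j)" for e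
    have "(\<Sum>e\<in>E. s e * trexp I (\<lambda>i j. H i j + (\<theta> * A e i j - \<kappa> * B e i j)))
        \<le> (\<Sum>e\<in>E. s e) * trexp I H"
      using expected_trexp_le[where u = u, OF I E A frame sH \<theta>]
      by (simp only: B_def s_def \<kappa>_def)
    from weighted_mean_le_exists[OF E _ pos this] obtain e
      where e: "e \<in> E" "0 < s e" "trexp I (\<lambda>i j. H i j + (\<theta> * A e i j - \<kappa> * B e i j)) \<le> trexp I H"
      by (auto simp: s_def dotp_self_nonneg)
    \<comment> \<open>Subtracts the projection onto \<open>u e\<close>, which lies in the range of
      \<open>P\<close>; the trace drops by exactly one.\<close>
    define P' where "P' = (\<lambda>i j. P i j - u e i * u e j / s e)"
    have P'v: "mvec I P' x = (\<lambda>i. mvec I P x i - (dotp I (u e) x / s e) * u e i)" for x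
    proof
      fix i
      have "mvec I P' x i = mvec I P x i - (\<Sum>j\<in>I. u e i * u e j / s e * x j)"
        by (simp add: P'_def mdiff_mvec) (simp add: mvec_def)
      also have "(\<Sum>j\<in>I. u e i * u e j / s e * x j) = (dotp I (u e) x / s e) * u e i"
        by (simp add: dotp_def sum_divide_distrib sum_distrib_left algebra_simps)
      finally show "mvec I P' x i = mvec I P x i - (dotp I (u e) x / s e) * u e i" .
    qed
    have "symm P'" using sP by (simp add: symm_def P'_def mult.commute)
    moreover have "mvec I P' (mvec I P' x) i = mvec I P' x i" if i: "i \<in> I" for x i
    proof -
      have "dotp I (u e) (mvec I P' x) = 0"
        unfolding P'v dotp_linear uP using e(2) by (simp add: s_def)
      then have "mvec I P' (mvec I P' x) i = mvec I P (mvec I P' x) i"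
        unfolding P'v[of "mvec I P' x"] by simp
      also have "\<dots> = mvec I P (mvec I P x) i - (dotp I (u e) x / s e) * mvec I P (u e) i"
        unfolding P'v mvec_linear ..
      also have "\<dots> = mvec I P' x i" using PP[OF i] by (simp add: P'v u_def)
      finally show ?thesis .
    qed
    moreover have "mtr I P' = real (card I) - real (Suc k)"
    proof -
      have "mtr I P' = mtr I P - (\<Sum>i\<in>I. u e i * u e i) / s e"
        by (simp add: mtr_def P'_def sum_subtractf sum_divide_distrib)
      also have "(\<Sum>i\<in>I. u e i * u e i) / s e = 1" using e(2) by (simp add: s_def dotp_def)
      finally show ?thesis using trP by simp
    qed
    moreover have "\<forall>x. (\<forall>f\<in>set (e # F). dotp I (v f) x = 0) \<longrightarrow> (\<forall>i\<in>I. mvec I P' x i = x i)"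
    proof (intro allI impI ballI)
      fix x i assume x: "\<forall>f\<in>set (e # F). dotp I (v f) x = 0" and i: "i \<in> I"
      have Px: "mvec I P x j = x j" if "j \<in> I" for j using ker[of x j] x that by simp
      have "dotp I (u e) x = dotp I (v e) x"
        unfolding uv by (rule dotp_cong) (simp_all add: Px)
      then have "dotp I (u e) x = 0" using x by simp
      then show "mvec I P' x i = x i" using Px[OF i] by (simp add: P'v)
    qed
    moreover have "trexp I (\<lambda>i j. \<theta> * msum_list A (e # F) i j + \<kappa> * ?L P' i j) \<le> real (card I) * exp \<kappa>"
    proof -
      \<comment> \<open>Hence \<open>L(P') = L(P) - B e\<close>, and the new exponent is exactly the
        one controlled by the choice of \<open>e\<close>.\<close>
      have "qform I P' (v f) = qform I P (v f) - (dotp I (u f) (u e))\<^sup>2 / s e" for f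
        unfolding P'v dotp_linear
        by (simp add: uu dotp_commute[of I "u e" "v f"] power2_eq_square)
      then have L': "?L P' = (\<lambda>i j. ?L P i j - B e i j)"
        by (simp add: compress_def B_def left_diff_distrib sum_subtractf)
      have "(\<lambda>i j. \<theta> * msum_list A (e # F) i j + \<kappa> * ?L P' i j)
          = (\<lambda>i j. H i j + (\<theta> * A e i j - \<kappa> * B e i j))"
        by (simp add: L' H_def msum_list_def algebra_simps)
      with e(3) pot show ?thesis by (simp add: H_def)
    qed
    ultimately have "?Inv (Suc k) (e # F) P'" using len F e(1) by auto
    then show ?case by blast
  qed
  from this[of "card I"] obtain F P where len: "length F = card I" and F: "set F \<subseteq> E" and sP: "symm P"
      and PP: "\<And>x i. i \<in> I \<Longrightarrow> mvec I P (mvec I P x) i = mvec I P x i"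
      and trP: "mtr I P = 0"
      and ker: "\<And>x i. (\<And>e. e \<in> set F \<Longrightarrow> dotp I (v e) x = 0) \<Longrightarrow> i \<in> I \<Longrightarrow> mvec I P x i = x i"
      and pot: "trexp I (\<lambda>i j. \<theta> * msum_list A F i j + \<kappa> * ?L P i j) \<le> real (card I) * exp \<kappa>"
    by auto
  have qP: "qform I P x = dotp I (mvec I P x) (mvec I P x)" for x
  proof -
    have "qform I P x = dotp I x (mvec I P (mvec I P x))"
      by (rule dotp_cong) (simp_all add: PP)
    then show ?thesis using symm_mvec_swap[OF sP] by simp
  qed
  have qP0: "0 \<le> qform I P x" for x unfolding qP by (rule dotp_self_nonneg)
  \<comment> \<open>Zero trace means that the squared lengths of the \<open>P v\<^sub>e\<close> sum
    to zero. So \<open>P\<close> kills the frame, and by reconstruction every vector.\<close>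
  have "(\<Sum>e\<in>E. qform I P (v e)) = 0" using frame_trace[OF I pars, of P] trP by simp
  then have "\<forall>e\<in>E. qform I P (v e) = 0" using E qP0 by (simp add: sum_nonneg_eq_0_iff)
  then have Pv: "mvec I P (v e) i = 0" if "e \<in> E" "i \<in> I" for e i
    using that I by (simp add: qP dotp_self_eq_0)
  have P0: "mvec I P x i = 0" if i: "i \<in> I" for x i
  proof -
    have "mvec I P x = mvec I P (\<lambda>j. \<Sum>f\<in>E. dotp I (v f) x * v f j)" by (rule mvec_cong, rule pars)
    then show ?thesis using Pv i by (simp add: mvec_linear)
  qed
  have "trexp I (\<lambda>i j. \<theta> * msum_list A F i j) \<le> trexp I (\<lambda>i j. \<theta> * msum_list A F i j + \<kappa> * ?L P i j)"
  proof (rule trexp_mono[OF I])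
    have sM: "symm (msum_list A F)" using A(1) F by (intro symm_msum_list) auto
    then show "symm (\<lambda>i j. \<theta> * msum_list A F i j)" by (simp add: symm_def)
    show "symm (\<lambda>i j. \<theta> * msum_list A F i j + \<kappa> * ?L P i j)" using sM sL[of P] by (simp add: symm_def)
    fix x
    have "0 \<le> qform I (?L P) x"
      unfolding qform_compress using qP0 A(2) by (intro sum_nonneg mult_nonneg_nonneg) auto
    then show "qform I (\<lambda>i j. \<theta> * msum_list A F i j) x
        \<le> qform I (\<lambda>i j. \<theta> * msum_list A F i j + \<kappa> * ?L P i j) x"
      unfolding madd_mvec mscale_mvec dotp_linear using \<kappa>0 by simp
  qed
  with pot have "trexp I (\<lambda>i j. \<theta> * msum_list A F i j) \<le> real (card I) * exp \<kappa>" by linarith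
  moreover have "\<forall>x. (\<forall>e\<in>set F. dotp I (v e) x = 0) \<longrightarrow> (\<forall>i\<in>I. x i = 0)"
    using ker P0 by metis
  ultimately show ?thesis using len F by blast
qed

text \<open>Several chosen pairs may share the same first index: the set counts its matrix once, the
  list once per pair. Nonnegativity makes this harmless.\<close>

lemma sum_image_le_sum_list:
  fixes g :: "'b \<Rightarrow> real"
  assumes "\<And>e. e \<in> set F \<Longrightarrow> 0 \<le> g (h e)"
  shows "(\<Sum>i\<in>h ` set F. g i) \<le> (\<Sum>e\<leftarrow>F. g (h e))"
  using assms
proof (induction F)
  case Nil
  then show ?case by simp
next
  case (Cons e F)
  have "(\<Sum>i\<in>h ` set (e # F). g i) \<le> g (h e) + (\<Sum>i\<in>h ` set F. g i)"
    using Cons.prems by (cases "h e \<in> h ` set F") (auto simp: insert_absorb)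
  then show ?case using Cons by fastforce
qed

section \<open>Transfer to matrices\<close>

text \<open>The zero extension makes a symmetric matrix symmetric at all indices, as
  \<open>symm\<close> demands.\<close>

definition entries :: "nat \<Rightarrow> real mat \<Rightarrow> nat \<Rightarrow> nat \<Rightarrow> real" where
  "entries n M = (\<lambda>a b. if a < n \<and> b < n then M $$ (a, b) else 0)"

lemma scalar_prod_dotp:
  "w \<in> carrier_vec n \<Longrightarrow> v \<bullet> w = dotp {..<n} (($) v) (($) w)"
  by (simp add: scalar_prod_def dotp_def lessThan_atLeast0)

lemma mult_mat_vec_entries:
  assumes "M \<in> carrier_mat n n" "v \<in> carrier_vec n" "a < n"
  shows "(M *\<^sub>v v) $ a = mvec {..<n} (entries n M) (($) v) a"
  using assms by (simp add: scalar_prod_def mvec_def entries_def lessThan_atLeast0)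

lemma quadratic_form_entries:
  assumes "M \<in> carrier_mat n n" "v \<in> carrier_vec n"
  shows "v \<bullet> (M *\<^sub>v v) = qform {..<n} (entries n M) (($) v)"
  using assms by (subst scalar_prod_dotp[of _ n]) (auto intro!: dotp_cong simp: mult_mat_vec_entries simp del: index_mult_mat_vec)

lemma symm_entries:
  assumes "M \<in> carrier_mat n n" "M\<^sup>T = M"
  shows "symm (entries n M)"
proof -
  have "M $$ (a, b) = M $$ (b, a)" if "a < n" "b < n" for a b
    using assms that by (metis carrier_matD index_transpose_mat(1))
  then show ?thesis by (auto simp: symm_def entries_def)
qed

lemma symmetric_psd_entries:
  assumes "symmetric_psd n M"
  shows "symm (entries n M)" "0 \<le> qform {..<n} (entries n M) x"
proof -
  from assms have M: "M \<in> carrier_mat n n" "M\<^sup>T = M"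
    and pos: "\<And>v. v \<in> carrier_vec n \<Longrightarrow> 0 \<le> v \<bullet> (M *\<^sub>v v)"
    by (auto simp: symmetric_psd_def)
  show "symm (entries n M)" by (rule symm_entries[OF M])
  have "0 \<le> vec n x \<bullet> (M *\<^sub>v vec n x)" by (rule pos) simp
  also have "\<dots> = qform {..<n} (entries n M) (($) (vec n x))"
    by (rule quadratic_form_entries[OF M(1)]) simp
  also have "mvec {..<n} (entries n M) (($) (vec n x)) = mvec {..<n} (entries n M) x"
    by (rule mvec_cong) simp
  also have "dotp {..<n} (($) (vec n x)) (mvec {..<n} (entries n M) x) = qform {..<n} (entries n M) x"
    by (rule dotp_cong) simp_all
  finally show "0 \<le> qform {..<n} (entries n M) x" .
qed

lemma eigbasis_mvec:
  assumes I: "finite I" and X: "symm X" and e: "eigbasis I X u d" and i: "i \<in> I"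
  shows "mvec I X x i = (\<Sum>k\<in>I. d k * dotp I (u k) x * u k i)"
proof -
  have kd: "dotp I (kron i) y = y i" for y
    using kron_mvec[OF I i, of y] by (simp add: dotp_def mvec_def)
  show ?thesis
    using eigbasis_bilinear[OF I X e, of "kron i" x]
    by (simp add: kd dotp_commute[of I "u _" "kron i"] mult.commute mult.left_commute)
qed

text \<open>Each eigenvalue is at most the sum of all, as none is negative. It provides
  \<open>X\<^sub>i / tr X\<^sub>i \<le> 1\<close>.\<close>

lemma psd_qform_le_mtr:
  assumes I: "finite I" and X: "symm X" "\<And>x. 0 \<le> qform I X x"
  shows "qform I X x \<le> mtr I X * dotp I x x"
proof -
  obtain u d where e: "eigbasis I X u d" using spectral_theorem[OF I X(1)] by blast
  have o: "onb I u" using e by (simp add: eigbasis_def)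
  have d0: "0 \<le> d k" if "k \<in> I" for k using eigbasis_eigenvalue[OF e that] X(2) by simp
  have "d k \<le> mtr I X" if "k \<in> I" for k
    unfolding mtr_eigbasis[OF I e] using that d0 I by (intro member_le_sum) auto
  then have "qform I X x \<le> (\<Sum>k\<in>I. mtr I X * (dotp I (u k) x)\<^sup>2)"
    unfolding eigbasis_qform[OF I X(1) e] by (intro sum_mono mult_right_mono) auto
  also have "\<dots> = mtr I X * dotp I x x"
    using onb_parseval[OF I o, of x x] by (simp add: sum_distrib_left power2_eq_square)
  finally show ?thesis .
qed

lemma compensator_bound:
  fixes \<theta> :: real
  assumes "0 < \<theta>"
  shows "2 * (exp (4 * \<theta>) - 1) * (2 * \<theta> + 1) \<le> 2 * exp (6 * \<theta>)"
proof -
  have "2 * (exp (4 * \<theta>) - 1) * (2 * \<theta> + 1) \<le> 2 * exp (4 * \<theta>) * exp (2 * \<theta>)"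
    using assms exp_ge_add_one_self[of "2 * \<theta>"] by (intro mult_mono) (auto simp: add.commute)
  also have "\<dots> = 2 * exp (6 * \<theta>)" by (simp add: exp_add[symmetric])
  finally show ?thesis .
qed

text \<open>The bound with \<open>\<theta>\<close> left free. The frame vectors are scaled
  eigenvectors of the \<open>X i\<close>, indexed by pairs, and \<open>S\<close> collects the first
  components of the selected pairs.\<close>

theorem psd_decomposition_subset:
  fixes X :: "nat \<Rightarrow> real mat"
  assumes n: "0 < n" and X: "\<And>i. i \<in> {1..m} \<Longrightarrow> symmetric_psd n (X i)"
    "\<And>i. i \<in> {1..m} \<Longrightarrow> X i \<noteq> 0\<^sub>m n n"
    and sum: "msum n X {1..m} = 1\<^sub>m n" and \<theta>: "0 < \<theta>"
  shows "\<exists>S \<subseteq> {1..m}. card S \<le> n \<and>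
    (let Y = msum n (\<lambda>i. (1 / mtrace (X i)) \<cdot>\<^sub>m X i) S in
       vec_space.rank n Y = n \<and> max_eigenvalue Y \<le> (ln (real n) + 2 * exp (6 * \<theta>)) / \<theta>)"
proof -
  let ?I = "{..<n}"
  have I: "finite ?I" by simp
  define f where "f i = entries n (X i)" for i
  have Xc: "X i \<in> carrier_mat n n" if "i \<in> {1..m}" for i
    using X(1)[OF that] by (simp add: symmetric_psd_def)
  have f: "symm (f i)" "\<And>x. 0 \<le> qform ?I (f i) x" if "i \<in> {1..m}" for i
    using symmetric_psd_entries[OF X(1)[OF that]] by (auto simp: f_def)
  have "\<forall>i. \<exists>u d. i \<in> {1..m} \<longrightarrow> eigbasis ?I (f i) u d"
    using spectral_theorem[OF I f(1)] by blast
  then obtain u d where ud: "\<And>i. i \<in> {1..m} \<Longrightarrow> eigbasis ?I (f i) (u i) (d i)"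
    by metis
  have o: "onb ?I (u i)" if "i \<in> {1..m}" for i using ud[OF that] by (simp add: eigbasis_def)
  have d0: "0 \<le> d i k" if "i \<in> {1..m}" "k \<in> ?I" for i k
    using eigbasis_eigenvalue[OF ud[OF that(1)] that(2)] f(2)[OF that(1)] by simp
  have tr: "mtrace (X i) = mtr ?I (f i)" if "i \<in> {1..m}" for i
    using Xc[OF that] by (simp add: mtrace_def mtr_def f_def entries_def)
  have trd: "mtrace (X i) = (\<Sum>k\<in>?I. d i k)" if "i \<in> {1..m}" for i
    using tr[OF that] mtr_eigbasis[OF I ud[OF that]] by simp
  \<comment> \<open>Zero trace would make all the nonnegative eigenvalues zero, hence the matrix
    itself.\<close>
  have trpos: "0 < mtrace (X i)" if i: "i \<in> {1..m}" for i
  proof (rule ccontr)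
    assume "\<not> 0 < mtrace (X i)"
    then have "(\<Sum>k\<in>?I. d i k) = 0"
      using trd[OF i] sum_nonneg[of ?I "d i"] d0[OF i] by simp
    then have "\<forall>k\<in>?I. d i k = 0" using sum_nonneg_eq_0_iff[OF I d0[OF i]] by simp
    then have z: "mvec ?I (f i) x a = 0" if "a \<in> ?I" for x a
      using eigbasis_mvec[OF I f(1)[OF i] ud[OF i] that] by simp
    have "f i a b = 0" if "a < n" "b < n" for a b
    proof -
      have "mvec ?I (f i) (kron b) a = f i a b"
        using kron_mvec[OF I, of b "f i a"] that by (simp add: mvec_def mult.commute)
      then show ?thesis using z[of a "kron b"] that by simp
    qed
    then have "X i = 0\<^sub>m n n" using Xc[OF i] by (intro eq_matI) (auto simp: f_def entries_def)
    with X(2)[OF i] show False by simp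
  qed
  have fsum: "(\<Sum>i\<in>{1..m}. f i a b) = kron a b" if "a < n" "b < n" for a b
  proof -
    have "(\<Sum>i\<in>{1..m}. f i a b) = msum n X {1..m} $$ (a, b)"
      using that by (simp add: msum_def f_def entries_def)
    then show ?thesis using that unfolding sum by (simp add: kron_def)
  qed
  have fsumv: "(\<Sum>i\<in>{1..m}. mvec ?I (f i) x a) = x a" if "a \<in> ?I" for x a
  proof -
    have "(\<Sum>i\<in>{1..m}. mvec ?I (f i) x a) = mvec ?I (\<lambda>a b. \<Sum>i\<in>{1..m}. f i a b) x a"
      by (simp add: msum_mvec)
    also have "\<dots> = mvec ?I kron x a" using that by (simp add: mvec_def fsum del: One_nat_def)
    finally show ?thesis using kron_mvec[OF I that] by simp
  qed
  define E where "E = {1..m} \<times> ?I"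
  \<comment> \<open>The square root of the eigenvalue makes \<open>X i\<close> the sum over
    \<open>k\<close> of the rank-one matrices of \<open>v (i, k)\<close>.\<close>
  define v where "v e = (\<lambda>a. sqrt (d (fst e) (snd e)) * u (fst e) (snd e) a)" for e
  define A where "A i = (\<lambda>a b. (1 / mtrace (X i)) * f i a b)" for i
  have qA: "qform ?I (A i) x = qform ?I (f i) x / mtrace (X i)" for i x
    unfolding A_def mscale_mvec dotp_linear by simp
  have A: "symm (A i)" "0 \<le> qform ?I (A i) x" "qform ?I (A i) x \<le> dotp ?I x x"
    if i: "i \<in> {1..m}" for i x
  proof -
    show "symm (A i)" using f(1)[OF i] by (simp add: A_def symm_def)
    show "0 \<le> qform ?I (A i) x" using f(2)[OF i] trpos[OF i] by (simp add: qA)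
    show "qform ?I (A i) x \<le> dotp ?I x x"
      using psd_qform_le_mtr[OF I f[OF i], of x] trpos[OF i] tr[OF i]
      by (simp add: qA field_simps)
  qed
  have vx: "dotp ?I (v (i, k)) x = sqrt (d i k) * dotp ?I (u i k) x" for i k x
    by (simp add: v_def dotp_linear)
  have pars: "x a = (\<Sum>e\<in>E. dotp ?I (v e) x * v e a)" if a: "a \<in> ?I" for x a
  proof -
    have "(\<Sum>e\<in>E. dotp ?I (v e) x * v e a) = (\<Sum>i\<in>{1..m}. \<Sum>k\<in>?I. dotp ?I (v (i, k)) x * v (i, k) a)"
      unfolding E_def by (simp add: sum.cartesian_product case_prod_beta)
    also have "\<dots> = (\<Sum>i\<in>{1..m}. mvec ?I (f i) x a)"
    proof (rule sum.cong[OF refl])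
      fix i assume i: "i \<in> {1..m}"
      have "dotp ?I (v (i, k)) x * v (i, k) a = d i k * dotp ?I (u i k) x * u i k a" if "k \<in> ?I" for k
      proof -
        have "dotp ?I (v (i, k)) x * v (i, k) a
            = (sqrt (d i k) * sqrt (d i k)) * dotp ?I (u i k) x * u i k a"
          unfolding vx unfolding v_def fst_conv snd_conv by (simp only: mult_ac)
        then show ?thesis using d0[OF i that] by simp
      qed
      then show "(\<Sum>k\<in>?I. dotp ?I (v (i, k)) x * v (i, k) a) = mvec ?I (f i) x a"
        unfolding eigbasis_mvec[OF I f(1)[OF i] ud[OF i] a] by (intro sum.cong) auto
    qed
    finally show ?thesis using fsumv[OF a] by simp
  qed
  \<comment> \<open>For fixed \<open>i\<close> the squared lengths of the \<open>v (i, k)\<close>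
    add up to the trace of \<open>X i\<close>, which undoes the normalisation of
    \<open>A i\<close>.\<close>
  have iso: "(\<Sum>e\<in>E. dotp ?I (v e) (v e) * qform ?I (A (fst e)) x) = dotp ?I x x" for x
  proof -
    have "(\<Sum>e\<in>E. dotp ?I (v e) (v e) * qform ?I (A (fst e)) x)
        = (\<Sum>i\<in>{1..m}. \<Sum>k\<in>?I. dotp ?I (v (i, k)) (v (i, k)) * qform ?I (A i) x)"
      unfolding E_def by (simp add: sum.cartesian_product case_prod_beta)
    also have "\<dots> = (\<Sum>i\<in>{1..m}. qform ?I (f i) x)"
    proof (rule sum.cong[OF refl])
      fix i assume i: "i \<in> {1..m}"
      have "dotp ?I (v (i, k)) (v (i, k)) = d i k" if "k \<in> ?I" for k
        using o[OF i] that d0[OF i that] by (simp add: v_def dotp_linear onb_def kron_def)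
      then have "(\<Sum>k\<in>?I. dotp ?I (v (i, k)) (v (i, k)) * qform ?I (A i) x) = mtrace (X i) * qform ?I (A i) x"
        by (simp add: trd[OF i] sum_distrib_right)
      then show "(\<Sum>k\<in>?I. dotp ?I (v (i, k)) (v (i, k)) * qform ?I (A i) x) = qform ?I (f i) x"
        using trpos[OF i] by (simp add: qA)
    qed
    also have "\<dots> = dotp ?I x (\<lambda>a. \<Sum>i\<in>{1..m}. mvec ?I (f i) x a)" by (simp add: dotp_sum_right)
    also have "\<dots> = dotp ?I x x" by (rule dotp_cong[OF refl fsumv])
    finally show ?thesis .
  qed
  let ?\<kappa> = "2 * (exp (4 * \<theta>) - 1) * (2 * \<theta> + 1)"
  have "\<exists>F. length F = card ?I \<and> set F \<subseteq> E \<and>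
    (\<forall>x. (\<forall>e\<in>set F. dotp ?I (v e) x = 0) \<longrightarrow> (\<forall>i\<in>?I. x i = 0)) \<and>
    trexp ?I (\<lambda>i j. \<theta> * msum_list (\<lambda>e. A (fst e)) F i j) \<le> real (card ?I) * exp ?\<kappa>"
    by (rule exists_basis_small_trexp[OF I _ _ _ _ pars iso \<theta>])
       (use A in \<open>auto simp: E_def\<close>)
  then obtain F where len: "length F = n" and F: "set F \<subseteq> E"
    and ker: "\<And>x. (\<And>e. e \<in> set F \<Longrightarrow> dotp ?I (v e) x = 0) \<Longrightarrow> (\<forall>i<n. x i = 0)"
    and pot: "trexp ?I (\<lambda>i j. \<theta> * msum_list (\<lambda>e. A (fst e)) F i j) \<le> real n * exp ?\<kappa>"
    unfolding card_lessThan Ball_def lessThan_iff by blast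
  define S where "S = fst ` set F"
  have S: "S \<subseteq> {1..m}" using F by (auto simp: S_def E_def)
  have cardS: "card S \<le> n"
    unfolding S_def using card_image_le[of "set F" fst] card_length[of F] len by simp
  define Y where "Y = msum n (\<lambda>i. (1 / mtrace (X i)) \<cdot>\<^sub>m X i) S"
  have Yc: "Y \<in> carrier_mat n n" by (simp add: Y_def msum_def)
  have Ye: "entries n Y = (\<lambda>a b. \<Sum>i\<in>S. A i a b)"
  proof (intro ext)
    fix a b
    show "entries n Y a b = (\<Sum>i\<in>S. A i a b)"
    proof (cases "a < n \<and> b < n")
      case True
      then have "entries n Y a b = (\<Sum>i\<in>S. ((1 / mtrace (X i)) \<cdot>\<^sub>m X i) $$ (a, b))"
        by (simp add: entries_def Y_def msum_def)
      also have "\<dots> = (\<Sum>i\<in>S. A i a b)"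
      proof (rule sum.cong[OF refl])
        fix i assume "i \<in> S"
        then have "X i \<in> carrier_mat n n" using Xc S by auto
        with True show "((1 / mtrace (X i)) \<cdot>\<^sub>m X i) $$ (a, b) = A i a b"
          by (simp add: A_def f_def entries_def)
      qed
      finally show ?thesis .
    qed (auto simp: entries_def A_def f_def)
  qed
  have qY: "qform ?I (entries n Y) x = (\<Sum>i\<in>S. qform ?I (A i) x)" for x
    unfolding Ye msum_mvec dotp_sum_right ..
  have "vec_space.rank n Y = n"
  proof -
    \<comment> \<open>A kernel vector of \<open>Y\<close> has zero form under every
      \<open>A i\<close> with \<open>i\<close> in \<open>S\<close>, since these forms are
      nonnegative. It is then orthogonal to every selected \<open>v e\<close>, hence zero by
      \<open>ker\<close>.\<close>
    have "det Y \<noteq> 0"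
    proof
      assume "det Y = 0"
      then obtain z where z: "z \<in> carrier_vec n" "z \<noteq> 0\<^sub>v n" "Y *\<^sub>v z = 0\<^sub>v n"
        using det_0_iff_vec_prod_zero_field[OF Yc] by auto
      have "qform ?I (entries n Y) (($) z) = 0"
        using quadratic_form_entries[OF Yc z(1)] z(1,3) by simp
      then have "\<forall>i\<in>S. qform ?I (A i) (($) z) = 0"
        unfolding qY using S A(2) by (subst (asm) sum_nonneg_eq_0_iff) (auto simp: S_def)
      then have qf: "qform ?I (f i) (($) z) = 0" if "i \<in> S" for i
        using that trpos[OF subsetD[OF S that]] by (auto simp: qA)
      have "dotp ?I (v e) (($) z) = 0" if e: "e \<in> set F" for e
      proof -
        obtain i k where ik: "e = (i, k)" by (cases e)
        have i: "i \<in> {1..m}" "i \<in> S" "k \<in> ?I" using F e ik by (force simp: E_def S_def)+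
        have "(\<Sum>k\<in>?I. d i k * (dotp ?I (u i k) (($) z))\<^sup>2) = 0"
          using qf[OF i(2)] eigbasis_qform[OF I f(1)[OF i(1)] ud[OF i(1)], of "($) z"] by simp
        then have "\<forall>k\<in>?I. d i k * (dotp ?I (u i k) (($) z))\<^sup>2 = 0"
          using d0[OF i(1)] by (subst (asm) sum_nonneg_eq_0_iff) auto
        then have "d i k = 0 \<or> dotp ?I (u i k) (($) z) = 0" using i(3) by auto
        then show ?thesis unfolding ik vx by auto
      qed
      from ker[OF this] have "\<forall>i<n. z $ i = 0" .
      with z(1,2) show False by (auto intro!: eq_vecI)
    qed
    then show ?thesis using vec_space.det_rank_iff[OF Yc] by simp
  qed
  moreover have "max_eigenvalue Y \<le> (ln (real n) + 2 * exp (6 * \<theta>)) / \<theta>"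
  proof -
    have sM: "symm (msum_list (\<lambda>e. A (fst e)) F)"
      using F A(1) by (intro symm_msum_list) (auto simp: E_def)
    \<comment> \<open>For a unit eigenvector \<open>x\<close>, \<open>exp (\<theta> * k)\<close> is
      at most the trace exponential of the list sum; take logarithms.\<close>
    have bound: "k \<le> (ln (real n) + 2 * exp (6 * \<theta>)) / \<theta>" if eig: "eigenvalue Y k" for k
    proof -
      obtain z where z: "z \<in> carrier_vec n" "z \<noteq> 0\<^sub>v n" "Y *\<^sub>v z = k \<cdot>\<^sub>v z"
        using eig Yc unfolding eigenvalue_def eigenvector_def by auto
      have "dotp ?I (($) z) (($) z) \<noteq> 0"
      proof
        assume "dotp ?I (($) z) (($) z) = 0"
        then have "\<forall>i<n. z $ i = 0" by (auto simp: dotp_self_eq_0)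
        with z(1,2) show False by (auto intro!: eq_vecI)
      qed
      then have pos: "0 < dotp ?I (($) z) (($) z)" using dotp_self_nonneg[of ?I "($) z"] by linarith
      define c where "c = 1 / sqrt (dotp ?I (($) z) (($) z))"
      define x where "x = (\<lambda>i. c * z $ i)"
      have x1: "dotp ?I x x = 1" using pos unfolding x_def dotp_linear c_def by (simp add: field_simps)
      have "mvec ?I (entries n Y) (($) z) a = k * z $ a" if "a \<in> ?I" for a
        using mult_mat_vec_entries[OF Yc z(1), of a] that z by simp
      then have "qform ?I (entries n Y) x = dotp ?I x (\<lambda>a. k * x a)"
        unfolding x_def mvec_scale by (intro dotp_cong) simp_all
      then have "k = qform ?I (entries n Y) x" using x1 by (simp add: dotp_linear)
      also have "\<dots> \<le> qform ?I (msum_list (\<lambda>e. A (fst e)) F) x"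
        unfolding qY S_def qform_msum_list using A(2) F
        by (intro sum_image_le_sum_list) (auto simp: E_def)
      finally have "\<theta> * k \<le> qform ?I (\<lambda>i j. \<theta> * msum_list (\<lambda>e. A (fst e)) F i j) x"
        using \<theta> by (simp add: mscale_mvec dotp_linear)
      then have "exp (\<theta> * k) \<le> exp (qform ?I (\<lambda>i j. \<theta> * msum_list (\<lambda>e. A (fst e)) F i j) x)" by simp
      also have "\<dots> \<le> trexp ?I (\<lambda>i j. \<theta> * msum_list (\<lambda>e. A (fst e)) F i j)"
        using sM x1 by (intro exp_qform_le_trexp) (auto simp: symm_def)
      also have "\<dots> \<le> real n * exp ?\<kappa>" by (rule pot)
      also have "\<dots> \<le> real n * exp (2 * exp (6 * \<theta>))"
        using compensator_bound[OF \<theta>] by (intro mult_left_mono) auto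
      also have "\<dots> = exp (ln (real n) + 2 * exp (6 * \<theta>))" using n by (simp add: exp_add)
      finally have "\<theta> * k \<le> ln (real n) + 2 * exp (6 * \<theta>)" by simp
      then show ?thesis using \<theta> by (simp add: field_simps)
    qed
    \<comment> \<open>\<open>Max\<close> is controlled only on finite nonempty sets. Symmetry of
      \<open>Y\<close> supplies a real eigenvalue.\<close>
    have "finite {k. eigenvalue Y k}"
      using card_finite_spectrum(1)[OF Yc] by (simp add: spectrum_def)
    moreover have "{k. eigenvalue Y k} \<noteq> {}"
    proof -
      have sY: "symm (entries n Y)"
        unfolding Ye symm_def using A(1) S by (intro allI sum.cong) (auto simp: symm_def)
      obtain k x where x: "\<exists>i<n. x i \<noteq> 0" and ev: "\<forall>i<n. mvec ?I (entries n Y) x i = k * x i"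
        using symmetric_eigenpair_exists[OF n sY] by blast
      have "Y *\<^sub>v vec n x = k \<cdot>\<^sub>v vec n x"
      proof (rule eq_vecI)
        fix i assume "i < dim_vec (k \<cdot>\<^sub>v vec n x)"
        then have i: "i < n" by simp
        have "(Y *\<^sub>v vec n x) $ i = mvec ?I (entries n Y) (($) (vec n x)) i"
          by (rule mult_mat_vec_entries[OF Yc _ i]) simp
        also have "mvec ?I (entries n Y) (($) (vec n x)) = mvec ?I (entries n Y) x"
          by (rule mvec_cong) simp
        finally show "(Y *\<^sub>v vec n x) $ i = (k \<cdot>\<^sub>v vec n x) $ i" using ev i by simp
      qed (use Yc in simp)
      moreover have "vec n x \<noteq> 0\<^sub>v n"
      proof
        assume *: "vec n x = 0\<^sub>v n"
        from x obtain i where "i < n" "x i \<noteq> 0" by blast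
        with arg_cong[OF *, of "\<lambda>w. w $ i"] show False by simp
      qed
      ultimately have "eigenvalue Y k"
        using Yc unfolding eigenvalue_def eigenvector_def by (intro exI[of _ "vec n x"]) auto
      then show ?thesis by blast
    qed
    ultimately show ?thesis unfolding max_eigenvalue_def using bound by (intro Max.boundedI) auto
  qed
  ultimately show ?thesis using S cardS unfolding Let_def Y_def by blast
qed

theorem theoremC1:
  shows "\<exists>c::real. c > 0 \<and>
    (\<forall>n::nat. n \<ge> 3 \<longrightarrow>
      (\<forall>(m::nat) (X::nat \<Rightarrow> real mat).
        (\<forall>i\<in>{1..m}. symmetric_psd n (X i) \<and> X i \<noteq> 0\<^sub>m n n) \<and>
        msum n X {1..m} = 1\<^sub>m n
        \<longrightarrow>
        (\<exists>S \<subseteq> {1..m}. card S \<le> n \<and>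
           (let Y = msum n (\<lambda>i. (1 / mtrace (X i)) \<cdot>\<^sub>m X i) S in
              vec_space.rank n Y = n \<and>
              max_eigenvalue Y \<le> c * ln (real n) / ln (ln (real n))))))"
proof (intro exI[of _ "18::real"] conjI allI impI)
  fix n m :: nat and X :: "nat \<Rightarrow> real mat"
  assume n: "3 \<le> n"
    and X: "(\<forall>i\<in>{1..m}. symmetric_psd n (X i) \<and> X i \<noteq> 0\<^sub>m n n) \<and> msum n X {1..m} = 1\<^sub>m n"
  \<comment> \<open>This makes \<open>exp (6 * \<theta>)\<close> equal to \<open>ln n\<close>, so
    the numerator is \<open>3 * ln n\<close>; division by \<open>\<theta>\<close> contributes 6,
    whence 18.\<close>
  define \<theta> where "\<theta> = ln (ln (real n)) / 6"
  \<comment> \<open>\<open>e < 3\<close> is needed strictly so that \<open>ln (ln n) > 0\<close>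
    already at \<open>n = 3\<close>. The bound \<open>1 + x + x^2\<close> at \<open>x = 1\<close>
    would only give 3, so it is used at \<open>1/4\<close>.\<close>
  have "exp 1 = exp (1/4 :: real) ^ 4" by (simp add: exp_of_nat_mult[symmetric])
  also have "\<dots> \<le> (1 + 1/4 + (1/4)\<^sup>2) ^ 4" by (intro power_mono exp_bound) auto
  also have "\<dots> < 3" by (simp add: power2_eq_square power4_eq_xxxx)
  finally have "exp 1 < (3::real)" .
  then have "1 < ln (real n)"
    using n ln_less_cancel_iff[of "exp 1" "real n"] by simp
  then have ll: "0 < ln (ln (real n))" and l0: "0 < ln (real n)" by (auto simp: ln_gt_zero)
  have \<theta>: "0 < \<theta>" using ll by (simp add: \<theta>_def)
  have "exp (6 * \<theta>) = ln (real n)" using l0 by (simp add: \<theta>_def)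
  then have eq: "(ln (real n) + 2 * exp (6 * \<theta>)) / \<theta> = 18 * ln (real n) / ln (ln (real n))"
    by (simp add: \<theta>_def)
  have "\<exists>S \<subseteq> {1..m}. card S \<le> n \<and>
    (let Y = msum n (\<lambda>i. (1 / mtrace (X i)) \<cdot>\<^sub>m X i) S in
       vec_space.rank n Y = n \<and> max_eigenvalue Y \<le> (ln (real n) + 2 * exp (6 * \<theta>)) / \<theta>)"
    using X n by (intro psd_decomposition_subset[OF _ _ _ _ \<theta>]) auto
  then show "\<exists>S \<subseteq> {1..m}. card S \<le> n \<and>
    (let Y = msum n (\<lambda>i. (1 / mtrace (X i)) \<cdot>\<^sub>m X i) S in
       vec_space.rank n Y = n \<and> max_eigenvalue Y \<le> 18 * ln (real n) / ln (ln (real n)))"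
    unfolding eq .
qed simp

end
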